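(* Let $\mathcal{H}$ be a Hopf superalgebra over $\mathbb{C}$ and $g\in\mathcal{H}$ a grouplike element with $g^2=1$ and $gxg^{-1}=(-1)^{p(x)}x$ for all homogeneous $x\in\mathcal{H}$, and let $H$ be the ordinary Hopf algebra associated with $(\mathcal{H},g)$ (see context). Let $\mathcal{J}\in\mathcal{H}\otimes\mathcal{H}$ be an even element, write $\mathcal{J}=\mathcal{J}_0+\mathcal{J}_1$ with $\mathcal{J}_0\in\mathcal{H}_0\otimes\mathcal{H}_0$ and $\mathcal{J}_1\in\mathcal{H}_1\otimes\mathcal{H}_1$, and define $J:=\mathcal{J}_0-(g\otimes 1)\mathcal{J}_1$. Then $J$ is an even twist for $H$ if and only if $\mathcal{J}$ is a twist for $\mathcal{H}$. Moreover, in this case $\mathcal{H}^{\mathcal{J}}$ (with the element $g$) corresponds to $H^J$ under the correspondence between Hopf algebras with a grouplike of square $1$ and Hopf superalgebras with a grouplike of square $1$ acting by parity. Thus there is a one-to-one correspondence between even twists for $H$ and twists for $\mathcal{H}$, given by $J\mapsto\mathcal{J}$.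
   Context: The ground field is $\mathbb{C}$. Supervector spaces are $\mathbb{Z}_2$-graded vector spaces with parity $p$ and commutativity constraint $\beta(v\otimes w)=(-1)^{p(v)p(w)}w\otimes v$. A Hopf superalgebra is a Hopf algebra in this symmetric tensor category; the product on tensor powers of $\mathcal{H}$ carries the usual sign, e.g. $(a\otimes b)(a'\otimes b')=(-1)^{p(a')p(b)}aa'\otimes bb'$. The correspondence: given an ordinary Hopf algebra $H$ and a grouplike $u\in H$ with $u^2=1$, put $\mathcal{H}=H$ as an algebra, graded by the adjoint action of $u$, and $g=u$. Write $\Delta(h)=\Delta_0(h)+\Delta_1(h)$ with $\Delta_i(h)\in H\otimes H_i$, and set $\tilde\Delta(h)=\Delta_0(h)-(-1)^{p(h)}(u\otimes 1)\Delta_1(h)$, $\tilde S(h)=u^{p(h)}S(h)$, same counit. Conversely, given $(\mathcal{H},g)$ with coproduct $\tilde\Delta=\tilde\Delta_0+\tilde\Delta_1$ ($\tilde\Delta_i(h)\in\mathcal{H}\otimes\mathcal{H}_i$) and antipode $\tilde S$, the associated ordinary Hopf algebra is $H=\mathcal{H}$ as an algebra with $\Delta(h)=\tilde\Delta_0(h)-(-1)^{p(h)}(g\otimes 1)\tilde\Delta_1(h)$, $S(h)=g^{p(h)}\tilde S(h)$, same counit, and $u=g$. A twist for a Hopf algebra (resp. superalgebra) $A$ is an invertible (resp. invertible even) $J\in A\otimes A$ with $(\Delta\otimes \mathrm{Id})(J)(J\otimes 1)=(\mathrm{Id}\otimes\Delta)(J)(1\otimes J)$ and $(\varepsilon\otimes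 \mathrm{Id})(J)=(\mathrm{Id}\otimes\varepsilon)(J)=1$. $A^J$ is the same algebra with the same counit, coproduct $\Delta^J(a)=J^{-1}\Delta(a)J$ and antipode $S^J(a)=Q^{-1}S(a)Q$, $Q=m\circ(S\otimes\mathrm{Id})(J)$. A twist $J$ for the ordinary Hopf algebra $H$ with its element $g$ is called even if it is invariant under $\mathrm{Ad}(g)$, i.e. commutes with $g\otimes g$. *)

theory Defs
  imports Complex_Main "HOL-Library.Poly_Mapping" "HOL-Library.Z2"
begin

section \<open>Complex vector spaces and unital associative algebras\<close>

class complex_vec = ab_group_add +
  fixes scaleC :: "complex \<Rightarrow> 'a \<Rightarrow> 'a" (infixr "*\<^sub>C" 75)
  assumes scaleC_right_distrib: "c *\<^sub>C (x + y) = c *\<^sub>C x + c *\<^sub>C y"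
    and scaleC_left_distrib: "(c + d) *\<^sub>C x = c *\<^sub>C x + d *\<^sub>C x"
    and scaleC_scaleC: "c *\<^sub>C (d *\<^sub>C x) = (c * d) *\<^sub>C x"
    and scaleC_one: "1 *\<^sub>C x = x"

text \<open>
  The class \<open>ring_1\<close> includes \<open>0 \<noteq> 1\<close>, which is no restriction for (super-) Hopf algebras:
  their counit maps 1 to 1.
\<close>

class complex_alg_1 = complex_vec + ring_1 +
  assumes mult_scaleC_left: "(c *\<^sub>C x) * y = c *\<^sub>C (x * y)"
    and mult_scaleC_right: "x * (c *\<^sub>C y) = c *\<^sub>C (x * y)"

global_interpretation cvs: vector_space "scaleC :: complex \<Rightarrow> 'a \<Rightarrow> 'a::complex_vec"
  by unfold_locales
    (simp_all add: scaleC_right_distrib scaleC_left_distrib scaleC_scaleC scaleC_one)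

instantiation complex :: complex_alg_1
begin
definition scaleC_complex :: "complex \<Rightarrow> complex \<Rightarrow> complex"
  where "scaleC_complex c x = c * x"
instance
  by standard (simp_all add: scaleC_complex_def algebra_simps)
end

instantiation poly_mapping :: (type, complex_vec) complex_vec
begin
definition scaleC_poly_mapping :: "complex \<Rightarrow> ('a \<Rightarrow>\<^sub>0 'b) \<Rightarrow> ('a \<Rightarrow>\<^sub>0 'b)"
  where "scaleC_poly_mapping c F = Poly_Mapping.map (scaleC c) F"
lemma lookup_scaleC:
  "Poly_Mapping.lookup (c *\<^sub>C F) k = c *\<^sub>C Poly_Mapping.lookup (F :: 'a \<Rightarrow>\<^sub>0 'b) k"
  by (simp add: scaleC_poly_mapping_def Poly_Mapping.map.rep_eq when_def)
instance
  by standard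
    (rule poly_mapping_eqI, simp add: lookup_scaleC lookup_add scaleC_right_distrib
      scaleC_left_distrib scaleC_scaleC scaleC_one)+
end

abbreviation clinear :: "('a::complex_vec \<Rightarrow> 'b::complex_vec) \<Rightarrow> bool"
  where "clinear \<equiv> Vector_Spaces.linear scaleC scaleC"

definition cbilinear :: "('a::complex_vec \<Rightarrow> 'b::complex_vec \<Rightarrow> 'c::complex_vec) \<Rightarrow> bool"
  where "cbilinear f \<longleftrightarrow> (\<forall>a. clinear (f a)) \<and> (\<forall>b. clinear (\<lambda>a. f a b))"

lemma clinearI:
  assumes "\<And>x y. f (x + y) = f x + f y" "\<And>c x. f (c *\<^sub>C x) = c *\<^sub>C f x"
  shows "clinear f"
  using assms
  by (simp add: Vector_Spaces.linear_def module_hom_def module_hom_axioms_def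
      cvs.vector_space_axioms cvs.module_axioms)

lemma clinear_add: "clinear f \<Longrightarrow> f (x + y) = f x + f y"
  and clinear_scaleC: "clinear f \<Longrightarrow> f (c *\<^sub>C x) = c *\<^sub>C f x"
  by (simp_all add: Vector_Spaces.linear_def module_hom_def module_hom_axioms_def)

lemma clinear_diff: "clinear f \<Longrightarrow> f (x - y) = f x - f y"
  by (metis clinear_add add_diff_cancel_right' diff_add_cancel)

lemma clinear_0: "clinear f \<Longrightarrow> f 0 = 0"
  by (metis clinear_diff diff_self)


section \<open>Tensor products\<close>

text \<open>
  The quotient of the free vector space on pairs by the subspace spanned by the
  bilinearity relations.
\<close>

definition tensor_relations :: "('a::complex_vec \<times> 'b::complex_vec \<Rightarrow>\<^sub>0 complex) set"
  where "tensor_relations =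
    {Poly_Mapping.single (a + a', b) 1 - Poly_Mapping.single (a, b) 1
      - Poly_Mapping.single (a', b) 1 | a a' b. True} \<union>
    {Poly_Mapping.single (a, b + b') 1 - Poly_Mapping.single (a, b) 1
      - Poly_Mapping.single (a, b') 1 | a b b'. True} \<union>
    {Poly_Mapping.single (c *\<^sub>C a, b) 1 - c *\<^sub>C Poly_Mapping.single (a, b) 1 | c a b. True} \<union>
    {Poly_Mapping.single (a, c *\<^sub>C b) 1 - c *\<^sub>C Poly_Mapping.single (a, b) 1 | c a b. True}"

definition tensor_rel ::
    "('a::complex_vec \<times> 'b::complex_vec \<Rightarrow>\<^sub>0 complex) \<Rightarrow> ('a \<times> 'b \<Rightarrow>\<^sub>0 complex) \<Rightarrow> bool"
  where "tensor_rel F F' \<longleftrightarrow> F - F' \<in> cvs.span tensor_relations"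

quotient_type (overloaded) ('a, 'b) tensor =
  "('a::complex_vec \<times> 'b::complex_vec) \<Rightarrow>\<^sub>0 complex" / tensor_rel
  unfolding equivp_reflp_symp_transp reflp_def symp_def transp_def tensor_rel_def
proof (intro conjI allI impI)
  show "F - F \<in> cvs.span tensor_relations" for F :: "'a \<times> 'b \<Rightarrow>\<^sub>0 complex"
    by (simp add: cvs.span_zero)
  show "F' - F \<in> cvs.span tensor_relations" if "F - F' \<in> cvs.span tensor_relations"
    for F F' :: "'a \<times> 'b \<Rightarrow>\<^sub>0 complex"
    using cvs.span_neg[OF that] by simp
  show "F - F'' \<in> cvs.span tensor_relations"
    if "F - F' \<in> cvs.span tensor_relations" "F' - F'' \<in> cvs.span tensor_relations"
    for F F' F'' :: "'a \<times> 'b \<Rightarrow>\<^sub>0 complex"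
    using cvs.span_add[OF that] by simp
qed

instantiation tensor :: (complex_vec, complex_vec) complex_vec
begin

lift_definition zero_tensor :: "('a, 'b) tensor" is 0 .

lift_definition plus_tensor :: "('a, 'b) tensor \<Rightarrow> ('a, 'b) tensor \<Rightarrow> ('a, 'b) tensor" is "(+)"
  unfolding tensor_rel_def by (simp only: add_diff_add cvs.span_add)

lift_definition uminus_tensor :: "('a, 'b) tensor \<Rightarrow> ('a, 'b) tensor" is uminus
  unfolding tensor_rel_def by (simp only: minus_diff_minus cvs.span_neg)

definition minus_tensor :: "('a, 'b) tensor \<Rightarrow> ('a, 'b) tensor \<Rightarrow> ('a, 'b) tensor"
  where "minus_tensor s t = s + - t"

lift_definition scaleC_tensor :: "complex \<Rightarrow> ('a, 'b) tensor \<Rightarrow> ('a, 'b) tensor" is scaleC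
  unfolding tensor_rel_def by (simp only: cvs.span_scale cvs.scale_right_diff_distrib[symmetric])

instance
proof
  fix x y z :: "('a, 'b) tensor" and c d :: complex
  note refl = cvs.span_zero
  show "x + y + z = x + (y + z)"
    by transfer (simp add: tensor_rel_def refl add.assoc)
  show "x + y = y + x"
    by transfer (simp add: tensor_rel_def refl add.commute)
  show "0 + x = x"
    by transfer (simp add: tensor_rel_def refl)
  show "- x + x = 0"
    by transfer (simp add: tensor_rel_def refl)
  show "x - y = x + - y"
    by (simp add: minus_tensor_def)
  show "c *\<^sub>C (x + y) = c *\<^sub>C x + c *\<^sub>C y"
    by transfer (simp add: tensor_rel_def refl scaleC_right_distrib)
  show "(c + d) *\<^sub>C x = c *\<^sub>C x + d *\<^sub>C x"
    by transfer (simp add: tensor_rel_def refl scaleC_left_distrib)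
  show "c *\<^sub>C (d *\<^sub>C x) = (c * d) *\<^sub>C x"
    by transfer (simp add: tensor_rel_def refl)
  show "1 *\<^sub>C x = x"
    by transfer (simp add: tensor_rel_def refl)
qed

end

lift_definition tensor :: "'a::complex_vec \<Rightarrow> 'b::complex_vec \<Rightarrow> ('a, 'b) tensor" (infixr "\<otimes>" 76)
  is "\<lambda>a b. Poly_Mapping.single (a, b) 1" .

text \<open>
  The linear map out of the tensor product induced by a bilinear map. It is computed on an
  arbitrary representative, and so is meaningful only for bilinear \<open>f\<close>; see
  \<open>tensor_lift_tensor\<close> and \<open>clinear_tensor_lift\<close> below.
\<close>

definition free_extend :: "('p \<Rightarrow> 'c::complex_vec) \<Rightarrow> ('p \<Rightarrow>\<^sub>0 complex) \<Rightarrow> 'c"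
  where "free_extend f F = (\<Sum>p\<in>Poly_Mapping.keys F. Poly_Mapping.lookup F p *\<^sub>C f p)"

definition tensor_lift ::
    "('a::complex_vec \<Rightarrow> 'b::complex_vec \<Rightarrow> 'c::complex_vec) \<Rightarrow> ('a, 'b) tensor \<Rightarrow> 'c"
  where "tensor_lift f t = free_extend (\<lambda>(a, b). f a b) (rep_tensor t)"

lemma clinear_free_extend: "clinear (free_extend f)"
proof (rule clinearI)
  fix F G :: "'a \<Rightarrow>\<^sub>0 complex" and c :: complex
  show "free_extend f (F + G) = free_extend f F + free_extend f G"
    unfolding free_extend_def
    by (rule setsum_keys_plus_distrib) (simp_all add: scaleC_left_distrib)
  have "free_extend f (c *\<^sub>C F) =
      (\<Sum>p\<in>Poly_Mapping.keys F. Poly_Mapping.lookup (c *\<^sub>C F) p *\<^sub>C f p)"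
    unfolding free_extend_def
    by (rule sum.mono_neutral_left)
      (auto simp: in_keys_iff lookup_scaleC scaleC_complex_def)
  then show "free_extend f (c *\<^sub>C F) = c *\<^sub>C free_extend f F"
    by (simp add: free_extend_def lookup_scaleC scaleC_complex_def cvs.scale_sum_right)
qed

lemma free_extend_single: "free_extend f (Poly_Mapping.single p c) = c *\<^sub>C f p"
  by (simp add: free_extend_def)

lemma free_extend_relations:
  assumes "cbilinear f" "F \<in> cvs.span tensor_relations"
  shows "free_extend (\<lambda>(a, b). f a b) F = 0"
proof -
  have f: "f (a + a') b = f a b + f a' b" "f a (b + b') = f a b + f a b'"
    "f (c *\<^sub>C a) b = c *\<^sub>C f a b" "f a (c *\<^sub>C b) = c *\<^sub>C f a b" for a a' b b' c
    using assms(1) clinear_add[of "f a"] clinear_add[of "\<lambda>a. f a b"]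
      clinear_scaleC[of "f a"] clinear_scaleC[of "\<lambda>a. f a b"]
    by (auto simp: cbilinear_def)
  let ?N = "{F. free_extend (\<lambda>(a, b). f a b) F = 0}"
  note lin = clinear_free_extend[of "\<lambda>(a, b). f a b"]
  have "cvs.subspace ?N"
    using lin by (simp add: cvs.subspace_def clinear_add clinear_scaleC clinear_0)
  moreover have "tensor_relations \<subseteq> ?N"
    by (auto simp: tensor_relations_def clinear_diff[OF lin] clinear_scaleC[OF lin]
        free_extend_single f)
  ultimately show ?thesis
    using cvs.span_minimal assms(2) by blast
qed

lemma tensor_lift_abs:
  assumes "cbilinear f"
  shows "tensor_lift f (abs_tensor F) = free_extend (\<lambda>(a, b). f a b) F"
proof -
  have "tensor_rel (rep_tensor (abs_tensor F)) F"
    by (rule Quotient3_rep_abs[OF Quotient3_tensor]) (simp add: tensor_rel_def cvs.span_zero)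
  then show ?thesis
    using free_extend_relations[OF assms, of "rep_tensor (abs_tensor F) - F"]
    by (simp add: tensor_lift_def tensor_rel_def clinear_diff[OF clinear_free_extend])
qed

lemma tensor_lift_tensor: "cbilinear f \<Longrightarrow> tensor_lift f (a \<otimes> b) = f a b"
  by (simp add: tensor.abs_eq tensor_lift_abs free_extend_single scaleC_one)

lemma clinear_tensor_lift:
  assumes "cbilinear f"
  shows "clinear (tensor_lift f)"
proof (rule clinearI)
  fix s t :: "('a, 'b) tensor" and c :: complex
  obtain F G where "s = abs_tensor F" "t = abs_tensor G"
    by (metis Quotient3_abs_rep[OF Quotient3_tensor])
  then show "tensor_lift f (s + t) = tensor_lift f s + tensor_lift f t"
    "tensor_lift f (c *\<^sub>C s) = c *\<^sub>C tensor_lift f s"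
    using clinear_free_extend
    by (simp_all add: plus_tensor.abs_eq scaleC_tensor.abs_eq tensor_lift_abs[OF assms]
        clinear_add[OF clinear_free_extend] clinear_scaleC[OF clinear_free_extend])
qed

lemma abs_tensor_eqI: "F - F' \<in> tensor_relations \<Longrightarrow> abs_tensor F = abs_tensor F'"
  using Quotient3_rel_abs[OF Quotient3_tensor] cvs.span_base unfolding tensor_rel_def by blast

lemma cbilinear_tensor: "cbilinear (\<otimes>)"
  unfolding cbilinear_def
proof (intro conjI allI clinearI)
  fix a a' :: 'a and b b' :: 'b and c :: complex
  show "(a + a') \<otimes> b = a \<otimes> b + a' \<otimes> b"
    unfolding tensor.abs_eq plus_tensor.abs_eq
    by (rule abs_tensor_eqI, unfold tensor_relations_def diff_diff_eq[symmetric])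
      (rule UnI1, rule UnI1, rule UnI1, rule CollectI,
        rule exI[of _ a], rule exI[of _ a'], rule exI[of _ b], simp)
  show "a \<otimes> (b + b') = a \<otimes> b + a \<otimes> b'"
    unfolding tensor.abs_eq plus_tensor.abs_eq
    by (rule abs_tensor_eqI, unfold tensor_relations_def diff_diff_eq[symmetric])
      (rule UnI1, rule UnI1, rule UnI2, rule CollectI,
        rule exI[of _ a], rule exI[of _ b], rule exI[of _ b'], simp)
  show "(c *\<^sub>C a) \<otimes> b = c *\<^sub>C (a \<otimes> b)"
    unfolding tensor.abs_eq scaleC_tensor.abs_eq
    by (rule abs_tensor_eqI, unfold tensor_relations_def)
      (rule UnI1, rule UnI2, rule CollectI,
        rule exI[of _ c], rule exI[of _ a], rule exI[of _ b], simp)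
  show "a \<otimes> (c *\<^sub>C b) = c *\<^sub>C (a \<otimes> b)"
    unfolding tensor.abs_eq scaleC_tensor.abs_eq
    by (rule abs_tensor_eqI, unfold tensor_relations_def)
      (rule UnI2, rule CollectI,
        rule exI[of _ c], rule exI[of _ a], rule exI[of _ b], simp)
qed

lemma
  fixes a a' :: "'a::complex_vec" and b b' :: "'b::complex_vec"
  shows tensor_add_left: "(a + a') \<otimes> b = a \<otimes> b + a' \<otimes> b"
  and tensor_add_right: "a \<otimes> (b + b') = a \<otimes> b + a \<otimes> b'"
  and tensor_scaleC_left: "(c *\<^sub>C a) \<otimes> b = c *\<^sub>C (a \<otimes> b)"
  and tensor_scaleC_right: "a \<otimes> (c *\<^sub>C b) = c *\<^sub>C (a \<otimes> b)"
proof -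
  have l: "clinear (\<lambda>a. a \<otimes> b)" for b :: 'b using cbilinear_tensor by (auto simp: cbilinear_def)
  have r: "clinear ((\<otimes>) a)" for a :: 'a using cbilinear_tensor by (auto simp: cbilinear_def)
  show "(a + a') \<otimes> b = a \<otimes> b + a' \<otimes> b" "(c *\<^sub>C a) \<otimes> b = c *\<^sub>C (a \<otimes> b)"
    by (rule clinear_add[OF l], rule clinear_scaleC[OF l])
  show "a \<otimes> (b + b') = a \<otimes> b + a \<otimes> b'" "a \<otimes> (c *\<^sub>C b) = c *\<^sub>C (a \<otimes> b)"
    by (rule clinear_add[OF r], rule clinear_scaleC[OF r])
qed

lemma tensor_induct [case_names zero add_scaled]:
  fixes t :: "('a::complex_vec, 'b::complex_vec) tensor"
  assumes "P 0" and "\<And>c a b t. P t \<Longrightarrow> P (c *\<^sub>C (a \<otimes> b) + t)"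
  shows "P t"
proof -
  have step: "P (abs_tensor (\<Sum>p\<in>X. Poly_Mapping.single p (h p)))"
    if "finite X" for X and h :: "'a \<times> 'b \<Rightarrow> complex"
    using that
  proof (induction X)
    case empty
    then show ?case using assms(1) by (simp add: zero_tensor.abs_eq)
  next
    case (insert p X)
    obtain a b where p: "p = (a, b)" by (cases p)
    have "Poly_Mapping.single p (h p) = h p *\<^sub>C Poly_Mapping.single (a, b) (1::complex)"
      by (rule poly_mapping_eqI) (simp add: p lookup_scaleC lookup_single when_def scaleC_complex_def)
    then have "abs_tensor (Poly_Mapping.single p (h p)) = h p *\<^sub>C (a \<otimes> b)"
      by (simp add: tensor.abs_eq scaleC_tensor.abs_eq)
    then show ?case
      using insert assms(2) by (simp add: plus_tensor.abs_eq[symmetric])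
  qed
  obtain F where "t = abs_tensor F"
    by (metis Quotient3_abs_rep[OF Quotient3_tensor])
  moreover have "F = (\<Sum>p\<in>Poly_Mapping.keys F. Poly_Mapping.single p (Poly_Mapping.lookup F p))"
    by (rule poly_mapping_eqI)
      (simp add: lookup_sum lookup_single when_def in_keys_iff)
  ultimately show ?thesis
    using step[of "Poly_Mapping.keys F" "Poly_Mapping.lookup F"] by simp
qed

definition tensor_map ::
    "('a::complex_vec \<Rightarrow> 'c::complex_vec) \<Rightarrow> ('b::complex_vec \<Rightarrow> 'd::complex_vec) \<Rightarrow>
     ('a, 'b) tensor \<Rightarrow> ('c, 'd) tensor"
  where "tensor_map f h = tensor_lift (\<lambda>a b. f a \<otimes> h b)"

definition tensor_assoc ::
    "(('a::complex_vec, 'b::complex_vec) tensor, 'c::complex_vec) tensor \<Rightarrow>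
     ('a, ('b, 'c) tensor) tensor"
  where "tensor_assoc = tensor_lift (\<lambda>s c. tensor_lift (\<lambda>a b. a \<otimes> (b \<otimes> c)) s)"

definition tensor_span ::
    "'a::complex_vec set \<Rightarrow> 'b::complex_vec set \<Rightarrow> ('a, 'b) tensor set"
  where "tensor_span V W = cvs.span {a \<otimes> b | a b. a \<in> V \<and> b \<in> W}"

definition tensor_mult ::
    "('a \<Rightarrow> 'a \<Rightarrow> 'a) \<Rightarrow> ('b \<Rightarrow> 'b \<Rightarrow> 'b) \<Rightarrow>
     ('a::complex_vec, 'b::complex_vec) tensor \<Rightarrow> ('a, 'b) tensor \<Rightarrow> ('a, 'b) tensor"
  where "tensor_mult mA mB s t =
    tensor_lift (\<lambda>a b. tensor_lift (\<lambda>a' b'. mA a a' \<otimes> mB b b') t) s"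


section \<open>Gradings by parity\<close>

definition parity_pow :: "'a::one \<Rightarrow> bit \<Rightarrow> 'a"
  where "parity_pow x i = (if i = 0 then 1 else x)"

definition super_space :: "(bit \<Rightarrow> 'a::complex_vec set) \<Rightarrow> bool"
  where "super_space G \<longleftrightarrow>
    (\<forall>i. cvs.subspace (G i)) \<and> G 0 \<inter> G 1 = {0} \<and> (\<forall>x. \<exists>y\<in>G 0. \<exists>z\<in>G 1. x = y + z)"

definition hcomp :: "(bit \<Rightarrow> 'a::complex_vec set) \<Rightarrow> bit \<Rightarrow> 'a \<Rightarrow> 'a"
  where "hcomp G i x = (THE y. y \<in> G i \<and> x - y \<in> G (i + 1))"

definition tensor_grading ::
    "(bit \<Rightarrow> 'a::complex_vec set) \<Rightarrow> (bit \<Rightarrow> 'b::complex_vec set) \<Rightarrow> bit \<Rightarrow> ('a, 'b) tensor set"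
  where "tensor_grading GA GB k =
    cvs.span {a \<otimes> b | a b i j. a \<in> GA i \<and> b \<in> GB j \<and> i + j = k}"

definition super_algebra :: "(bit \<Rightarrow> 'a::complex_alg_1 set) \<Rightarrow> bool"
  where "super_algebra G \<longleftrightarrow>
    super_space G \<and> 1 \<in> G 0 \<and> (\<forall>i j. \<forall>x\<in>G i. \<forall>y\<in>G j. x * y \<in> G (i + j))"

text \<open>
  The product of the tensor product of two superalgebras, with the sign rule; arbitrary elements
  are decomposed into homogeneous ones.
\<close>

definition super_tensor_mult ::
    "(bit \<Rightarrow> 'a set) \<Rightarrow> ('a \<Rightarrow> 'a \<Rightarrow> 'a) \<Rightarrow> (bit \<Rightarrow> 'b set) \<Rightarrow> ('b \<Rightarrow> 'b \<Rightarrow> 'b) \<Rightarrow>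
     ('a::complex_vec, 'b::complex_vec) tensor \<Rightarrow> ('a, 'b) tensor \<Rightarrow> ('a, 'b) tensor"
  where "super_tensor_mult GA mA GB mB s t =
    tensor_lift (\<lambda>a b. tensor_lift (\<lambda>a' b'.
      \<Sum>i\<in>{0, 1}. \<Sum>j\<in>{0, 1}.
        parity_pow (-1) (i * j) *\<^sub>C (mA a (hcomp GA i a') \<otimes> mB (hcomp GB j b) b')) t) s"


section \<open>Hopf algebras and Hopf superalgebras\<close>

text \<open>Only the coalgebra data and the antipode; the algebra structure is that of the type.\<close>

record (overloaded) ('a::complex_vec) hopf_data =
  comult :: "'a::complex_vec \<Rightarrow> ('a, 'a) tensor"
  counit :: "'a \<Rightarrow> complex"
  antipode :: "'a \<Rightarrow> 'a"

abbreviation mult2 ::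
    "('a::complex_alg_1, 'a) tensor \<Rightarrow> ('a, 'a) tensor \<Rightarrow> ('a, 'a) tensor"
  where "mult2 \<equiv> tensor_mult (*) (*)"

abbreviation mult3 ::
    "('a::complex_alg_1, ('a, 'a) tensor) tensor \<Rightarrow> ('a, ('a, 'a) tensor) tensor \<Rightarrow>
     ('a, ('a, 'a) tensor) tensor"
  where "mult3 \<equiv> tensor_mult (*) mult2"

abbreviation smult2 ::
    "(bit \<Rightarrow> 'a::complex_alg_1 set) \<Rightarrow> ('a, 'a) tensor \<Rightarrow> ('a, 'a) tensor \<Rightarrow> ('a, 'a) tensor"
  where "smult2 G \<equiv> super_tensor_mult G (*) G (*)"

abbreviation smult3 ::
    "(bit \<Rightarrow> 'a::complex_alg_1 set) \<Rightarrow> ('a, ('a, 'a) tensor) tensor \<Rightarrow>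
     ('a, ('a, 'a) tensor) tensor \<Rightarrow> ('a, ('a, 'a) tensor) tensor"
  where "smult3 G \<equiv> super_tensor_mult G (*) (tensor_grading G G) (smult2 G)"

text \<open>
  The Hopf axioms relative to a product \<open>m2\<close> on the tensor square. Even maps
  involve no signs, so only this product distinguishes the two cases.
\<close>

definition hopf_axioms ::
    "(('a, 'a) tensor \<Rightarrow> ('a, 'a) tensor \<Rightarrow> ('a, 'a) tensor) \<Rightarrow> 'a::complex_alg_1 hopf_data \<Rightarrow> bool"
  where "hopf_axioms m2 A \<longleftrightarrow>
    clinear (comult A) \<and> clinear (counit A) \<and> clinear (antipode A) \<and>
    (\<forall>x. tensor_assoc (tensor_map (comult A) id (comult A x)) =
         tensor_map id (comult A) (comult A x)) \<and>
    (\<forall>x. tensor_lift (\<lambda>a b. counit A a *\<^sub>C b) (comult A x) = x) \<and>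
    (\<forall>x. tensor_lift (\<lambda>a b. counit A b *\<^sub>C a) (comult A x) = x) \<and>
    comult A 1 = 1 \<otimes> 1 \<and> (\<forall>x y. comult A (x * y) = m2 (comult A x) (comult A y)) \<and>
    counit A 1 = 1 \<and> (\<forall>x y. counit A (x * y) = counit A x * counit A y) \<and>
    (\<forall>x. tensor_lift (\<lambda>a b. antipode A a * b) (comult A x) = counit A x *\<^sub>C 1) \<and>
    (\<forall>x. tensor_lift (\<lambda>a b. a * antipode A b) (comult A x) = counit A x *\<^sub>C 1)"

definition hopf_algebra :: "'a::complex_alg_1 hopf_data \<Rightarrow> bool"
  where "hopf_algebra A \<longleftrightarrow> hopf_axioms mult2 A"

definition hopf_superalgebra :: "(bit \<Rightarrow> 'a::complex_alg_1 set) \<Rightarrow> 'a hopf_data \<Rightarrow> bool"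
  where "hopf_superalgebra G A \<longleftrightarrow>
    super_algebra G \<and>
    (\<forall>i. \<forall>x\<in>G i. comult A x \<in> tensor_grading G G i) \<and>
    (\<forall>x\<in>G 1. counit A x = 0) \<and>
    (\<forall>i. \<forall>x\<in>G i. antipode A x \<in> G i) \<and>
    hopf_axioms (smult2 G) A"

definition grouplike :: "'a::complex_alg_1 hopf_data \<Rightarrow> 'a \<Rightarrow> bool"
  where "grouplike A x \<longleftrightarrow> comult A x = x \<otimes> x \<and> counit A x = 1"

definition inverse_wrt :: "('m \<Rightarrow> 'm \<Rightarrow> 'm) \<Rightarrow> 'm \<Rightarrow> 'm \<Rightarrow> 'm"
  where "inverse_wrt m e x = (THE y. m x y = e \<and> m y x = e)"

abbreviation ring_inv :: "'a::ring_1 \<Rightarrow> 'a"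
  where "ring_inv \<equiv> inverse_wrt (*) 1"

definition acts_by_parity :: "(bit \<Rightarrow> 'a::complex_alg_1 set) \<Rightarrow> 'a \<Rightarrow> bool"
  where "acts_by_parity G g \<longleftrightarrow>
    (\<forall>i. \<forall>x\<in>G i. g * x * ring_inv g = parity_pow (-1) i *\<^sub>C x)"


section \<open>Twists\<close>

text \<open>
  The triple tensor power is bracketed to the right; elements bracketed to the left are
  transported along \<open>tensor_assoc\<close>.
\<close>

definition twist_axioms ::
    "(('a, 'a) tensor \<Rightarrow> ('a, 'a) tensor \<Rightarrow> ('a, 'a) tensor) \<Rightarrow>
     (('a, ('a, 'a) tensor) tensor \<Rightarrow> ('a, ('a, 'a) tensor) tensor \<Rightarrow> ('a, ('a, 'a) tensor) tensor) \<Rightarrow>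
     'a::complex_alg_1 hopf_data \<Rightarrow> ('a, 'a) tensor \<Rightarrow> bool"
  where "twist_axioms m2 m3 A J \<longleftrightarrow>
    (\<exists>K. m2 J K = 1 \<otimes> 1 \<and> m2 K J = 1 \<otimes> 1) \<and>
    m3 (tensor_assoc (tensor_map (comult A) id J)) (tensor_assoc (J \<otimes> 1)) =
    m3 (tensor_map id (comult A) J) (1 \<otimes> J) \<and>
    tensor_lift (\<lambda>a b. counit A a *\<^sub>C b) J = 1 \<and>
    tensor_lift (\<lambda>a b. counit A b *\<^sub>C a) J = 1"

definition twist :: "'a::complex_alg_1 hopf_data \<Rightarrow> ('a, 'a) tensor \<Rightarrow> bool"
  where "twist A J \<longleftrightarrow> twist_axioms mult2 mult3 A J"

definition even_twist :: "'a::complex_alg_1 hopf_data \<Rightarrow> 'a \<Rightarrow> ('a, 'a) tensor \<Rightarrow> bool"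
  where "even_twist A g J \<longleftrightarrow> twist A J \<and> mult2 (g \<otimes> g) J = mult2 J (g \<otimes> g)"

definition super_twist ::
    "(bit \<Rightarrow> 'a::complex_alg_1 set) \<Rightarrow> 'a hopf_data \<Rightarrow> ('a, 'a) tensor \<Rightarrow> bool"
  where "super_twist G A J \<longleftrightarrow>
    J \<in> tensor_grading G G 0 \<and> twist_axioms (smult2 G) (smult3 G) A J"

definition twist_Q :: "'a::complex_alg_1 hopf_data \<Rightarrow> ('a, 'a) tensor \<Rightarrow> 'a"
  where "twist_Q A J = tensor_lift (\<lambda>a b. antipode A a * b) J"

definition twisted_wrt ::
    "(('a, 'a) tensor \<Rightarrow> ('a, 'a) tensor \<Rightarrow> ('a, 'a) tensor) \<Rightarrow>
     'a::complex_alg_1 hopf_data \<Rightarrow> ('a, 'a) tensor \<Rightarrow> 'a hopf_data"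
  where "twisted_wrt m2 A J =
    \<lparr> comult = (\<lambda>a. m2 (m2 (inverse_wrt m2 (1 \<otimes> 1) J) (comult A a)) J),
      counit = counit A,
      antipode = (\<lambda>a. ring_inv (twist_Q A J) * antipode A a * twist_Q A J) \<rparr>"

definition twisted :: "'a::complex_alg_1 hopf_data \<Rightarrow> ('a, 'a) tensor \<Rightarrow> 'a hopf_data"
  where "twisted A J = twisted_wrt mult2 A J"

definition super_twisted ::
    "(bit \<Rightarrow> 'a::complex_alg_1 set) \<Rightarrow> 'a hopf_data \<Rightarrow> ('a, 'a) tensor \<Rightarrow> 'a hopf_data"
  where "super_twisted G A J = twisted_wrt (smult2 G) A J"


section \<open>The correspondence\<close>

text \<open>
  The same formulas lead from a Hopf superalgebra to the ordinary Hopf algebra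
  and back; they are extended linearly from homogeneous \<open>h\<close>.
\<close>

definition parity_change ::
    "(bit \<Rightarrow> 'a::complex_alg_1 set) \<Rightarrow> 'a \<Rightarrow> 'a hopf_data \<Rightarrow> 'a hopf_data"
  where "parity_change G g A =
    \<lparr> comult = (\<lambda>h. \<Sum>i\<in>{0, 1}.
        tensor_map id (hcomp G 0) (comult A (hcomp G i h))
        - parity_pow (-1) i *\<^sub>C
            mult2 (g \<otimes> 1) (tensor_map id (hcomp G 1) (comult A (hcomp G i h)))),
      counit = counit A,
      antipode = (\<lambda>h. \<Sum>i\<in>{0, 1}. parity_pow g i * antipode A (hcomp G i h)) \<rparr>"

definition ad_grading :: "'a::complex_alg_1 \<Rightarrow> bit \<Rightarrow> 'a set"
  where "ad_grading u i = {x. u * x * ring_inv u = parity_pow (-1) i *\<^sub>C x}"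

definition hopf_with_involution :: "'a::complex_alg_1 hopf_data \<Rightarrow> 'a \<Rightarrow> bool"
  where "hopf_with_involution A u \<longleftrightarrow> hopf_algebra A \<and> grouplike A u \<and> u^2 = 1"

definition super_with_parity_element ::
    "(bit \<Rightarrow> 'a::complex_alg_1 set) \<Rightarrow> 'a hopf_data \<Rightarrow> 'a \<Rightarrow> bool"
  where "super_with_parity_element G A g \<longleftrightarrow>
    hopf_superalgebra G A \<and> grouplike A g \<and> g^2 = 1 \<and> acts_by_parity G g"

definition associated_hopf ::
    "(bit \<Rightarrow> 'a::complex_alg_1 set) \<Rightarrow> 'a hopf_data \<Rightarrow> 'a \<Rightarrow> 'a hopf_data"
  where "associated_hopf G A g = parity_change G g A"

definition associated_super :: "'a::complex_alg_1 hopf_data \<Rightarrow> 'a \<Rightarrow> 'a hopf_data"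
  where "associated_super A u = parity_change (ad_grading u) u A"

definition corresponds ::
    "(bit \<Rightarrow> 'a::complex_alg_1 set) \<Rightarrow> 'a hopf_data \<Rightarrow> 'a \<Rightarrow> 'a hopf_data \<Rightarrow> 'a \<Rightarrow> bool"
  where "corresponds G As g A u \<longleftrightarrow>
    super_with_parity_element G As g \<and> hopf_with_involution A u \<and>
    A = associated_hopf G As g \<and> u = g \<and>
    As = associated_super A u \<and> G = ad_grading u"

text \<open>
  The components of a tensor in \<open>G 0 \<otimes> G 0\<close> and \<open>G 1 \<otimes> G 1\<close> are obtained by applying the
  projections in both factors.
\<close>

definition twist_change ::
    "(bit \<Rightarrow> 'a::complex_alg_1 set) \<Rightarrow> 'a \<Rightarrow> ('a, 'a) tensor \<Rightarrow> ('a, 'a) tensor"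
  where "twist_change G g J =
    tensor_map (hcomp G 0) (hcomp G 0) J
    - mult2 (g \<otimes> 1) (tensor_map (hcomp G 1) (hcomp G 1) J)"


section \<open>Evaluation on homogeneous elements\<close>

lemma hcomp_unique:
  assumes "super_space G" "y \<in> G i" "x - y \<in> G (i + 1)"
  shows "hcomp G i x = y"
  unfolding hcomp_def
proof (rule the_equality)
  show "y \<in> G i \<and> x - y \<in> G (i + 1)" using assms by simp
next
  fix y' assume y': "y' \<in> G i \<and> x - y' \<in> G (i + 1)"
  have sub: "cvs.subspace (G i)" "cvs.subspace (G (i + 1))"
    and disj: "G i \<inter> G (i + 1) = {0}"
    using assms(1) by (cases i; auto simp: super_space_def)+
  have "y' - y \<in> G i" using y' assms sub(1) by (simp add: cvs.subspace_diff)
  moreover have "(x - y) - (x - y') \<in> G (i + 1)"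
    using y' assms sub(2) cvs.subspace_diff by blast
  ultimately have "y' - y \<in> G i \<inter> G (i + 1)" by simp
  then have "y' - y = 0" using disj by blast
  then show "y' = y" by simp
qed

lemma hcomp_in:
  assumes "super_space G"
  shows "hcomp G i x \<in> G i" "x - hcomp G i x \<in> G (i + 1)"
proof -
  obtain y z where yz: "y \<in> G 0" "z \<in> G 1" "x = y + z"
    using assms unfolding super_space_def by blast
  have "\<exists>y. y \<in> G i \<and> x - y \<in> G (i + 1)"
    using yz by (cases i) force+
  then show "hcomp G i x \<in> G i" "x - hcomp G i x \<in> G (i + 1)"
    using hcomp_unique[OF assms] by blast+
qed

lemma hcomp_homogeneous:
  assumes "super_space G" "x \<in> G i"
  shows "hcomp G j x = (if i = j then x else 0)"
  using assms
  by (cases i; cases j; auto intro!: hcomp_unique simp: super_space_def cvs.subspace_0)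

lemma clinear_hcomp:
  assumes "super_space G"
  shows "clinear (hcomp G i)"
proof (rule clinearI)
  have sub: "cvs.subspace (G j)" for j using assms by (simp add: super_space_def)
  fix x y c
  show "hcomp G i (x + y) = hcomp G i x + hcomp G i y"
  proof (rule hcomp_unique[OF assms])
    show "hcomp G i x + hcomp G i y \<in> G i"
      by (intro cvs.subspace_add sub hcomp_in assms)
    show "x + y - (hcomp G i x + hcomp G i y) \<in> G (i + 1)"
      unfolding add_diff_add by (intro cvs.subspace_add sub hcomp_in assms)
  qed
  show "hcomp G i (c *\<^sub>C x) = c *\<^sub>C hcomp G i x"
  proof (rule hcomp_unique[OF assms])
    show "c *\<^sub>C hcomp G i x \<in> G i"
      by (intro cvs.subspace_scale sub hcomp_in assms)
    show "c *\<^sub>C x - c *\<^sub>C hcomp G i x \<in> G (i + 1)"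
      unfolding cvs.scale_right_diff_distrib[symmetric]
      by (intro cvs.subspace_scale sub hcomp_in assms)
  qed
qed

lemma cbilinear_tensor_comp:
  assumes "clinear f" "clinear h"
  shows "cbilinear (\<lambda>a b. f a \<otimes> h b)"
  using assms unfolding cbilinear_def
  by (auto intro!: clinearI simp: clinear_add clinear_scaleC
      tensor_add_left tensor_add_right tensor_scaleC_left tensor_scaleC_right)

lemma tensor_map_tensor:
  "clinear f \<Longrightarrow> clinear h \<Longrightarrow> tensor_map f h (a \<otimes> b) = f a \<otimes> h b"
  by (simp add: tensor_map_def tensor_lift_tensor cbilinear_tensor_comp)

lemma tensor_lift_fun_add:
  "tensor_lift (\<lambda>a b. f a b + h a b) t = tensor_lift f t + tensor_lift h t"
  by (simp add: tensor_lift_def free_extend_def case_prod_unfold scaleC_right_distrib sum.distrib)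

lemma tensor_lift_fun_scaleC:
  "tensor_lift (\<lambda>a b. c *\<^sub>C f a b) t = c *\<^sub>C tensor_lift f t"
  by (simp add: tensor_lift_def free_extend_def case_prod_unfold cvs.scale_sum_right mult.commute)

lemma super_tensor_mult_homogeneous:
  assumes GA: "super_space GA" and GB: "super_space GB"
    and mA: "cbilinear mA" and mB: "cbilinear mB"
    and a': "a' \<in> GA i" and b: "b \<in> GB j"
  shows "super_tensor_mult GA mA GB mB (a \<otimes> b) (a' \<otimes> b') =
    parity_pow (-1) (i * j) *\<^sub>C (mA a a' \<otimes> mB b b')"
proof -
  let ?F = "\<lambda>a b a' b'. \<Sum>i\<in>{0, 1}. \<Sum>j\<in>{0, 1}.
    parity_pow (-1) (i * j) *\<^sub>C (mA a (hcomp GA i a') \<otimes> mB (hcomp GB j b) b')"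
  have A: "mA (x + y) z = mA x z + mA y z" "mA z (x + y) = mA z x + mA z y"
    "mA (c *\<^sub>C x) z = c *\<^sub>C mA x z" "mA z (c *\<^sub>C x) = c *\<^sub>C mA z x" for x y z c
    using mA clinear_add[of "mA z"] clinear_add[of "\<lambda>x. mA x z"]
      clinear_scaleC[of "mA z"] clinear_scaleC[of "\<lambda>x. mA x z"]
    by (auto simp: cbilinear_def)
  have B: "mB (x + y) z = mB x z + mB y z" "mB z (x + y) = mB z x + mB z y"
    "mB (c *\<^sub>C x) z = c *\<^sub>C mB x z" "mB z (c *\<^sub>C x) = c *\<^sub>C mB z x" for x y z c
    using mB clinear_add[of "mB z"] clinear_add[of "\<lambda>x. mB x z"]
      clinear_scaleC[of "mB z"] clinear_scaleC[of "\<lambda>x. mB x z"]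
    by (auto simp: cbilinear_def)
  note T = A B tensor_add_left tensor_add_right tensor_scaleC_left tensor_scaleC_right
    clinear_add[OF clinear_hcomp[OF GA]] clinear_scaleC[OF clinear_hcomp[OF GA]]
    clinear_add[OF clinear_hcomp[OF GB]] clinear_scaleC[OF clinear_hcomp[OF GB]]
  have F: "?F (x + y) b = (\<lambda>a' b'. ?F x b a' b' + ?F y b a' b')"
    "?F (c *\<^sub>C x) b = (\<lambda>a' b'. c *\<^sub>C ?F x b a' b')"
    "?F a (u + v) = (\<lambda>a' b'. ?F a u a' b' + ?F a v a' b')"
    "?F a (c *\<^sub>C u) = (\<lambda>a' b'. c *\<^sub>C ?F a u a' b')" for x y a b c u v
    by (intro ext; simp add: T scaleC_right_distrib mult.commute algebra_simps)+
  have inner: "cbilinear (?F a b)" for a b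
    unfolding cbilinear_def
    by (intro conjI allI clinearI; simp add: T scaleC_right_distrib mult.commute algebra_simps)
  have outer: "cbilinear (\<lambda>a b. tensor_lift (?F a b) t)" for t
    unfolding cbilinear_def
    by (intro conjI allI clinearI; simp only: F tensor_lift_fun_add tensor_lift_fun_scaleC)
  have z: "mA x 0 = 0" "mB 0 y = 0" "(0::'a) \<otimes> (w::'b) = 0" "(v::'a) \<otimes> (0::'b) = 0" for x y v w
    using A(2)[of x 0 0] B(1)[of 0 0 y] tensor_add_left[of 0 0 w] tensor_add_right[of v 0 0]
    by simp_all
  have "super_tensor_mult GA mA GB mB (a \<otimes> b) (a' \<otimes> b') = ?F a b a' b'"
    unfolding super_tensor_mult_def
    by (rule trans[OF tensor_lift_tensor[OF outer] tensor_lift_tensor[OF inner]])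
  also have "\<dots> = parity_pow (-1) (i * j) *\<^sub>C (mA a a' \<otimes> mB b b')"
    by (cases i; cases j; simp add: hcomp_homogeneous[OF GA a'] hcomp_homogeneous[OF GB b] z)
  finally show ?thesis .
qed

lemma twist_change_decomposition:
  assumes G: "super_space G"
    and J0: "J0 \<in> tensor_span (G 0) (G 0)" and J1: "J1 \<in> tensor_span (G 1) (G 1)"
  shows "twist_change G g (J0 + J1) = J0 - mult2 (g \<otimes> 1) J1"
proof -
  have lin: "clinear (tensor_map (hcomp G i) (hcomp G j))" for i j
    unfolding tensor_map_def
    by (intro clinear_tensor_lift cbilinear_tensor_comp clinear_hcomp G)
  have z: "0 \<otimes> (y::'a) = (0::('a, 'a) tensor)" for y
    using tensor_add_left[of 0 0 y] by simp
  have eq: "tensor_map (hcomp G i) (hcomp G i) t = (if i = j then t else 0)"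
    if "t \<in> tensor_span (G j) (G j)" for i j t
  proof -
    let ?V = "{t. tensor_map (hcomp G i) (hcomp G i) t = (if i = j then t else 0)}"
    have "cvs.subspace ?V"
      by (auto simp: cvs.subspace_def clinear_0[OF lin] clinear_add[OF lin] clinear_scaleC[OF lin])
    moreover have "{a \<otimes> b | a b. a \<in> G j \<and> b \<in> G j} \<subseteq> ?V"
      by (auto simp: tensor_map_tensor clinear_hcomp[OF G] hcomp_homogeneous[OF G] z)
    ultimately show ?thesis
      using that cvs.span_minimal unfolding tensor_span_def by blast
  qed
  show ?thesis
    using eq[OF J0] eq[OF J1] by (simp add: twist_change_def clinear_add[OF lin])
qed

end

theory Submission
  imports Defs
begin

text \<open>
  Write \<open>p\<close> for the parity. All the sign rules of the Hopf superalgebra are absorbed by one linear map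
  on the tensor square,
    \<open>\<phi> (a \<otimes> b) = a g\<^bsup>p(b)\<^esup> \<otimes> b\<close>.
  Since \<open>g\<close> commutes with elements up to the sign of their parity, moving \<open>g\<^bsup>p(b)\<^esup>\<close> past \<open>a'\<close> in
  \<open>\<phi> (a \<otimes> b) \<phi> (a' \<otimes> b')\<close> produces exactly the sign in the product of the super tensor square.
  So \<open>\<phi>\<close> is an isomorphism from the super tensor square to the ordinary one, and it is its own
  inverse because \<open>g\<^sup>2 = 1\<close> (\<open>unbraid_super_tensor_mult\<close>, \<open>unbraid_unbraid\<close>). The formulas for the
  coproduct of the associated Hopf algebra and for \<open>J\<close> both say: apply \<open>\<phi>\<close>
  (\<open>parity_change_comult\<close>, \<open>twist_change_eq\<close>). On the triple tensor power the
  same construction, with \<open>\<phi>\<close> applied to the last two factors, carries the two sides of the twist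
  equation and of coassociativity to the corresponding ordinary expressions (\<open>Dl_unbraid\<close>,
  \<open>Dr_unbraid\<close>). Hence \<open>\<J>\<close> is a twist if and only if \<open>J = \<phi> \<J>\<close> is one, and \<open>\<phi>\<close> is
  the claimed bijection; an element of the tensor square is even exactly when it commutes
  with \<open>g \<otimes> g\<close>.

  For the correspondence between the twisted objects, the passage between Hopf algebras and Hopf
  superalgebras is proved once for a product that may be either of the two
  (\<open>graded_hopf_parity_change\<close>), and it is an involution. It therefore remains to know that an
  ordinary Hopf algebra twisted by \<open>J\<close> is a Hopf algebra (\<open>hopf_algebra_twisted\<close>); the super
  case follows by transporting the result back, where the twisted antipodes agree because the
  element \<open>Q\<close> is the same on both sides and even.
\<close>

section \<open>The tensor product of two algebras\<close>

lemma clinear_ident: "clinear (\<lambda>x. x)" "clinear id"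
  by (auto intro: clinearI)

lemma clinear_zero_fun: "clinear (\<lambda>x. 0)"
  by (auto intro: clinearI)

lemma clinear_plus: "clinear f \<Longrightarrow> clinear h \<Longrightarrow> clinear (\<lambda>x. f x + h x)"
  by (auto intro!: clinearI simp: clinear_add clinear_scaleC scaleC_right_distrib algebra_simps)

lemma clinear_uminus: "clinear f \<Longrightarrow> clinear (\<lambda>x. - f x)"
  by (auto intro!: clinearI simp: clinear_add clinear_scaleC algebra_simps)

lemma clinear_minus: "clinear f \<Longrightarrow> clinear h \<Longrightarrow> clinear (\<lambda>x. f x - h x)"
  using clinear_plus[of f "\<lambda>x. - h x"] clinear_uminus[of h] by simp

lemma clinear_scaled: "clinear f \<Longrightarrow> clinear (\<lambda>x. c *\<^sub>C f x)"
  by (auto intro!: clinearI simp: clinear_add clinear_scaleC scaleC_right_distrib scaleC_scaleC mult.commute)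

lemma clinear_scaled_vec: "clinear f \<Longrightarrow> clinear (\<lambda>x. f x *\<^sub>C v)"
  by (auto intro!: clinearI simp: clinear_add clinear_scaleC scaleC_left_distrib scaleC_scaleC scaleC_complex_def)

lemma clinear_mult_left: "clinear f \<Longrightarrow> clinear (\<lambda>x. f x * (y :: 'a::complex_alg_1))"
  by (auto intro!: clinearI simp: clinear_add clinear_scaleC distrib_right mult_scaleC_left)

lemma clinear_mult_right: "clinear f \<Longrightarrow> clinear (\<lambda>x. (y :: 'a::complex_alg_1) * f x)"
  by (auto intro!: clinearI simp: clinear_add clinear_scaleC distrib_left mult_scaleC_right)

lemma clinear_tensor_left: "clinear f \<Longrightarrow> clinear (\<lambda>x. f x \<otimes> b)"
  by (auto intro!: clinearI simp: clinear_add clinear_scaleC tensor_add_left tensor_scaleC_left)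

lemma clinear_tensor_right: "clinear f \<Longrightarrow> clinear (\<lambda>x. a \<otimes> f x)"
  by (auto intro!: clinearI simp: clinear_add clinear_scaleC tensor_add_right tensor_scaleC_right)

lemma clinear_comp: "clinear h \<Longrightarrow> clinear f \<Longrightarrow> clinear (\<lambda>x. h (f x))"
  by (auto intro!: clinearI simp: clinear_add clinear_scaleC)

lemma clinear_lift_fun:
  "(\<And>a b. clinear (\<lambda>x. F x a b)) \<Longrightarrow> clinear (\<lambda>x. tensor_lift (F x) t)"
proof (rule clinearI)
  assume F: "\<And>a b. clinear (\<lambda>x. F x a b)"
  have "F (x + y) = (\<lambda>a b. F x a b + F y a b)" "F (c *\<^sub>C x) = (\<lambda>a b. c *\<^sub>C F x a b)" for x y c
    by (intro ext clinear_add[OF F] clinear_scaleC[OF F])+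
  then show "tensor_lift (F (x + y)) t = tensor_lift (F x) t + tensor_lift (F y) t"
    "tensor_lift (F (c *\<^sub>C x)) t = c *\<^sub>C tensor_lift (F x) t" for x y c
    by (simp_all add: tensor_lift_fun_add tensor_lift_fun_scaleC)
qed

lemma clinear_lift_arg:
  "cbilinear F \<Longrightarrow> clinear f \<Longrightarrow> clinear (\<lambda>x. tensor_lift F (f x))"
  by (rule clinear_comp[OF clinear_tensor_lift])

lemma cbilinearI:
  "(\<And>a. clinear (\<lambda>b. f a b)) \<Longrightarrow> (\<And>b. clinear (\<lambda>a. f a b)) \<Longrightarrow> cbilinear f"
  by (simp add: cbilinear_def)

lemma clinear_tensor_map:
  "clinear f \<Longrightarrow> clinear h \<Longrightarrow> clinear k \<Longrightarrow> clinear (\<lambda>x. tensor_map f h (k x))"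
  unfolding tensor_map_def by (intro clinear_lift_arg cbilinear_tensor_comp)

text \<open>
  As conditional rewrite rules these prove the linearity of composite expressions automatically, so
  that identities between such expressions need only be checked on pure tensors.
\<close>

lemmas clinear_intros = clinear_ident clinear_zero_fun clinear_plus clinear_uminus clinear_minus
  clinear_scaled clinear_scaled_vec clinear_mult_left clinear_mult_right
  clinear_tensor_left clinear_tensor_right clinear_lift_fun clinear_lift_arg
  cbilinearI clinear_tensor_map

lemma tensor_assoc_tensor: "tensor_assoc (s \<otimes> c) = tensor_lift (\<lambda>a b. a \<otimes> (b \<otimes> c)) s"
  unfolding tensor_assoc_def by (simp add: tensor_lift_tensor clinear_intros)

lemma clinear_tensor_assoc: "clinear f \<Longrightarrow> clinear (\<lambda>x. tensor_assoc (f x))"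
  unfolding tensor_assoc_def by (simp add: clinear_intros)

lemma tensor_eqI:
  assumes "clinear f" "clinear h" "\<And>a b. f (a \<otimes> b) = h (a \<otimes> b)"
  shows "f t = h t"
  by (induction t rule: tensor_induct)
    (simp_all add: assms(3) clinear_0[OF assms(1)] clinear_0[OF assms(2)]
      clinear_add[OF assms(1)] clinear_add[OF assms(2)]
      clinear_scaleC[OF assms(1)] clinear_scaleC[OF assms(2)])

lemma tensor_mult_tensor:
  "tensor_mult (*) (*) (a \<otimes> b) (a' \<otimes> b') = (a * a') \<otimes> (b * b' :: 'b::complex_alg_1)"
  for a :: "'a::complex_alg_1"
  unfolding tensor_mult_def by (simp add: tensor_lift_tensor clinear_intros)

lemma clinear_tensor_mult:
  fixes f :: "'c::complex_vec \<Rightarrow> ('a::complex_alg_1, 'b::complex_alg_1) tensor"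
  assumes "clinear f"
  shows "clinear (\<lambda>x. tensor_mult (*) (*) (f x) t)" "clinear (\<lambda>x. tensor_mult (*) (*) t (f x))"
  using assms unfolding tensor_mult_def by (simp_all add: clinear_intros)

text \<open>
  A linear functional with value \<open>1\<close> at \<open>1\<close> on each factor separates \<open>1 \<otimes> 1\<close> from \<open>0\<close>, as the class
  of unital algebras requires of the tensor product.
\<close>

lemma unital_functional:
  obtains f :: "'a::complex_alg_1 \<Rightarrow> complex" where "clinear f" "f 1 = 1"
proof -
  interpret vector_space_pair "scaleC :: complex \<Rightarrow> 'a \<Rightarrow> 'a" "scaleC :: complex \<Rightarrow> complex \<Rightarrow> complex" ..
  have "cvs.independent {1::'a}" by simp
  from linear_independent_extend[OF this, of "\<lambda>_. 1"]
  obtain f :: "'a \<Rightarrow> complex" where "clinear f" "f 1 = 1" by blast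
  then show ?thesis by (rule that)
qed

text \<open>
  With this instance \<open>mult2\<close> and \<open>mult3\<close> become ring multiplication, so that computations in tensor
  powers can use the ring lemmas.
\<close>

instantiation tensor :: (complex_alg_1, complex_alg_1) complex_alg_1
begin
definition times_tensor :: "('a, 'b) tensor \<Rightarrow> ('a, 'b) tensor \<Rightarrow> ('a, 'b) tensor"
  where "times_tensor = tensor_mult (*) (*)"
definition one_tensor :: "('a, 'b) tensor"
  where "one_tensor = 1 \<otimes> 1"
instance
proof
  fix r s t :: "('a, 'b) tensor" and c :: complex
  note L = clinear_tensor_mult clinear_ident
  note T = tensor_mult_tensor
  show "r * s * t = r * (s * t)"
    unfolding times_tensor_def
    apply (rule tensor_eqI[where t=r], simp add: L, simp add: L)
    apply (rule tensor_eqI[where t=s], simp_all add: L)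
    apply (rule tensor_eqI[where t=t], simp_all add: L T mult.assoc)
    done
  show "1 * t = t" "t * 1 = t"
    unfolding times_tensor_def one_tensor_def
    by (rule tensor_eqI[where t=t]; simp add: L T)+
  show "(r + s) * t = r * t + s * t"
    unfolding times_tensor_def by (rule clinear_add) (simp add: L)
  show "t * (r + s) = t * r + t * s"
    unfolding times_tensor_def by (rule clinear_add) (simp add: L)
  show "(c *\<^sub>C s) * t = c *\<^sub>C (s * t)"
    unfolding times_tensor_def by (rule clinear_scaleC[of "\<lambda>s. tensor_mult (*) (*) s t"]) (simp add: L)
  show "s * (c *\<^sub>C t) = c *\<^sub>C (s * t)"
    unfolding times_tensor_def by (rule clinear_scaleC) (simp add: L)
  obtain f :: "'a \<Rightarrow> complex" where f: "clinear f" "f 1 = 1" by (rule unital_functional)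
  obtain h :: "'b \<Rightarrow> complex" where h: "clinear h" "h 1 = 1" by (rule unital_functional)
  have B: "cbilinear (\<lambda>a b. f a * h b)" using f h by (simp add: clinear_intros)
  have "tensor_lift (\<lambda>a b. f a * h b) (1 \<otimes> 1) = 1"
    by (simp add: tensor_lift_tensor[OF B] f h)
  then show "(0 :: ('a, 'b) tensor) \<noteq> 1"
    using clinear_0[OF clinear_tensor_lift[OF B]] by (auto simp: one_tensor_def)
qed
end

lemma mult2_eq: "tensor_mult (*) (*) = (*)"
  by (simp add: times_tensor_def)

lemma tensor_times: "(a \<otimes> b) * (a' \<otimes> b') = (a * a') \<otimes> (b * b')"
  by (simp add: times_tensor_def tensor_mult_tensor)

section \<open>Gradings by conjugation with an involution\<close>

lemma tensor_0: "(0::'a::complex_vec) \<otimes> (b::'b::complex_vec) = 0" "(a::'a) \<otimes> (0::'b) = 0"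
  using tensor_add_left[of "0::'a" 0 b] tensor_add_right[of a "0::'b" 0] by simp_all

abbreviation sign :: "bit \<Rightarrow> complex" where "sign \<equiv> parity_pow (-1)"

lemma sign_add: "sign i * sign j = sign (i + j)"
  by (cases i; cases j; simp add: parity_pow_def)

lemma parity_pow_add: "g * g = 1 \<Longrightarrow> parity_pow g i * parity_pow g j = parity_pow (g::'a::ring_1) (i + j)"
  by (cases i; cases j; simp add: parity_pow_def)

lemma inverse_wrt_unique:
  fixes x y :: "'a::ring_1"
  assumes "x * y = 1" "y * x = 1"
  shows "ring_inv x = y"
  unfolding inverse_wrt_def
proof (rule the_equality)
  show "x * y = 1 \<and> y * x = 1" using assms by simp
  show "z = y" if "x * z = 1 \<and> z * x = 1" for z
    using that assms by (metis mult.assoc mult.left_neutral mult.right_neutral)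
qed

lemma ad_grading_iff:
  assumes "g * g = 1"
  shows "x \<in> ad_grading g i \<longleftrightarrow> g * x = sign i *\<^sub>C (x * g)"
proof -
  have "g * x * g = c *\<^sub>C x \<longleftrightarrow> g * x = c *\<^sub>C (x * g)" for c
  proof
    assume "g * x * g = c *\<^sub>C x"
    then have "g * x * g * g = c *\<^sub>C (x * g)" by (simp only: mult_scaleC_left)
    then show "g * x = c *\<^sub>C (x * g)" by (simp add: mult.assoc assms)
  qed (simp add: mult_scaleC_left mult.assoc assms)
  then show ?thesis
    by (simp add: ad_grading_def inverse_wrt_unique[OF assms assms])
qed

lemma ad_grading_0_iff: "g * g = 1 \<Longrightarrow> x \<in> ad_grading g 0 \<longleftrightarrow> g * x = x * g"
  by (simp add: ad_grading_iff parity_pow_def)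

lemma parity_pow_commute:
  assumes "g * g = 1" "x \<in> ad_grading g i"
  shows "parity_pow g j * x = sign (j * i) *\<^sub>C (x * parity_pow g j)"
  using assms by (cases j; simp add: ad_grading_iff parity_pow_def)

lemma subspace_ad_grading: "g * g = 1 \<Longrightarrow> cvs.subspace (ad_grading g i)"
  by (simp add: cvs.subspace_def ad_grading_iff distrib_left distrib_right
      mult_scaleC_left mult_scaleC_right scaleC_right_distrib scaleC_scaleC mult.commute)

lemma eq_minus_self_iff: "v = - v \<longleftrightarrow> v = (0 :: 'a::complex_vec)"
proof
  assume "v = - v"
  then have "2 *\<^sub>C v = 0"
    using scaleC_left_distrib[of 1 1 v] by (simp add: eq_neg_iff_add_eq_0 scaleC_one)
  then show "v = 0" by simp
qed simp

lemma ad_grading_disjoint: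
  assumes g: "g * g = 1" and "x \<in> ad_grading g 0" "x \<in> ad_grading g 1"
  shows "x = 0"
proof -
  have "x * g = - (x * g)"
    using assms by (simp add: ad_grading_iff parity_pow_def scaleC_one)
  then have "x * g * g = 0" by (simp add: eq_minus_self_iff)
  then show ?thesis by (simp add: mult.assoc g)
qed

lemma ad_grading_decomposition:
  assumes g: "g * g = 1"
  shows "\<exists>y\<in>ad_grading g 0. \<exists>z\<in>ad_grading g 1. x = y + z"
proof (intro bexI)
  have gg: "g * (g * y) = y" for y using g by (simp flip: mult.assoc)
  have "x + x = 2 *\<^sub>C x" using scaleC_left_distrib[of 1 1 x] by (simp add: scaleC_one)
  then show "x = (1/2) *\<^sub>C (x + g * x * g) + (1/2) *\<^sub>C (x - g * x * g)"
    by (simp add: scaleC_scaleC scaleC_one flip: scaleC_right_distrib)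
  show "(1/2) *\<^sub>C (x + g * x * g) \<in> ad_grading g 0" "(1/2) *\<^sub>C (x - g * x * g) \<in> ad_grading g 1"
    by (simp_all add: ad_grading_iff g gg parity_pow_def mult_scaleC_left mult_scaleC_right algebra_simps
        scaleC_one)
qed

lemma super_algebra_ad_grading:
  assumes g: "g * g = 1"
  shows "super_algebra (ad_grading g)"
proof -
  have "0 \<in> ad_grading g i" for i
    by (simp add: ad_grading_iff g)
  then have "super_space (ad_grading g)"
    unfolding super_space_def
    using ad_grading_disjoint[OF g] ad_grading_decomposition[OF g] subspace_ad_grading[OF g] by auto
  moreover have "x * y \<in> ad_grading g (i + j)" if "x \<in> ad_grading g i" "y \<in> ad_grading g j" for x y i j
  proof -
    have gx: "g * x = sign i *\<^sub>C (x * g)" and gy: "g * y = sign j *\<^sub>C (y * g)"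
      using that by (simp_all add: ad_grading_iff g)
    have "g * (x * y) = (g * x) * y" by (simp add: mult.assoc)
    also have "\<dots> = sign i *\<^sub>C (x * (g * y))" unfolding gx by (simp add: mult_scaleC_left mult.assoc)
    also have "\<dots> = sign (i + j) *\<^sub>C (x * y * g)"
      unfolding gy by (simp add: mult_scaleC_right mult.assoc scaleC_scaleC sign_add)
    finally show ?thesis by (simp add: ad_grading_iff g)
  qed
  moreover have "1 \<in> ad_grading g 0" by (simp add: ad_grading_0_iff g)
  ultimately show ?thesis by (simp add: super_algebra_def)
qed

lemma super_space_ad_grading: "g * g = 1 \<Longrightarrow> super_space (ad_grading g)"
  using super_algebra_ad_grading super_algebra_def by blast

text \<open>
  Subspaces of the two eigenspaces of conjugation that together span everything must be the whole
  eigenspaces, because the eigenspaces for \<open>1\<close> and \<open>-1\<close> meet in \<open>0\<close>. This identifies both the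
  given grading and the induced grading of the tensor square with eigenspace gradings.
\<close>

lemma eq_ad_grading:
  assumes g: "g * g = 1" and sub: "\<And>i. G i \<subseteq> ad_grading g i"
    and ex: "\<And>x. \<exists>y\<in>G 0. \<exists>z\<in>G 1. x = y + z"
  shows "G = ad_grading g"
proof (rule ext, rule equalityI[OF sub], rule subsetI)
  fix i x assume x: "x \<in> ad_grading g i"
  obtain y z where yz: "y \<in> G 0" "z \<in> G 1" "x = y + z" using ex by blast
  note diff = cvs.subspace_diff[OF subspace_ad_grading[OF g]]
  show "x \<in> G i"
  proof (cases i)
    case zero
    have "z \<in> ad_grading g 0" using diff[of x 0 y] x yz sub zero by auto
    then have "z = 0" using ad_grading_disjoint[OF g] yz sub by blast
    then show ?thesis using yz zero by simp
  next
    case one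
    have "y \<in> ad_grading g 1" using diff[of x 1 z] x yz sub one by auto
    then have "y = 0" using ad_grading_disjoint[OF g] yz sub by blast
    then show ?thesis using yz one by simp
  qed
qed

lemma acts_by_parity_eq_ad_grading:
  assumes "g * g = 1" "super_space G" "acts_by_parity G g"
  shows "G = ad_grading g"
  using assms by (intro eq_ad_grading) (auto simp: ad_grading_def acts_by_parity_def super_space_def)

text \<open>
  In particular, a tensor is even exactly when it commutes with \<open>g \<otimes> v\<close>.
\<close>

lemma tensor_grading_ad_grading:
  assumes g: "g * g = 1" and v: "v * v = 1"
  shows "tensor_grading (ad_grading g) (ad_grading v) = ad_grading (g \<otimes> v)"
proof (rule eq_ad_grading)
  let ?T = "tensor_grading (ad_grading g) (ad_grading v)"
  have gv: "(g \<otimes> v) * (g \<otimes> v) = 1" by (simp add: tensor_times g v one_tensor_def)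
  then show "(g \<otimes> v) * (g \<otimes> v) = 1" .
  have pure: "a \<otimes> b \<in> ad_grading (g \<otimes> v) (j + k)" if "a \<in> ad_grading g j" "b \<in> ad_grading v k" for a b j k
    unfolding ad_grading_iff[OF gv] sign_add[symmetric]
    using that by (simp add: ad_grading_iff g v tensor_times tensor_scaleC_left tensor_scaleC_right
          scaleC_scaleC mult.commute)
  show "?T i \<subseteq> ad_grading (g \<otimes> v) i" for i
    unfolding tensor_grading_def
  proof (rule cvs.span_minimal[OF _ subspace_ad_grading[OF gv]])
    show "{a \<otimes> b |a b j k. a \<in> ad_grading g j \<and> b \<in> ad_grading v k \<and> j + k = i} \<subseteq> ad_grading (g \<otimes> v) i"
      using pure by blast
  qed
  have gen: "a \<otimes> b \<in> ?T (i + j)" if "a \<in> ad_grading g i" "b \<in> ad_grading v j" for a b i j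
    unfolding tensor_grading_def by (rule cvs.span_base) (use that in blast)
  have sub: "cvs.subspace (?T i)" for i by (simp add: tensor_grading_def)
  show "\<exists>y\<in>?T 0. \<exists>z\<in>?T 1. t = y + z" for t
  proof (induction t rule: tensor_induct)
    case zero
    show ?case
      by (intro bexI[of _ 0]) (simp_all add: cvs.subspace_0 sub)
  next
    case (add_scaled c a b t)
    obtain y z where yz: "y \<in> ?T 0" "z \<in> ?T 1" "t = y + z" using add_scaled by blast
    obtain a0 a1 where a: "a0 \<in> ad_grading g 0" "a1 \<in> ad_grading g 1" "a = a0 + a1"
      using ad_grading_decomposition[OF g] by blast
    obtain b0 b1 where b: "b0 \<in> ad_grading v 0" "b1 \<in> ad_grading v 1" "b = b0 + b1"
      using ad_grading_decomposition[OF v] by blast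
    have "c *\<^sub>C (a0 \<otimes> b0 + a1 \<otimes> b1) + y \<in> ?T 0" "c *\<^sub>C (a0 \<otimes> b1 + a1 \<otimes> b0) + z \<in> ?T 1"
      using gen[OF a(1) b(1)] gen[OF a(2) b(2)] gen[OF a(1) b(2)] gen[OF a(2) b(1)] yz
      by (auto intro!: cvs.subspace_add[OF sub] cvs.subspace_scale[OF sub])
    moreover have "c *\<^sub>C (a \<otimes> b) + t =
        (c *\<^sub>C (a0 \<otimes> b0 + a1 \<otimes> b1) + y) + (c *\<^sub>C (a0 \<otimes> b1 + a1 \<otimes> b0) + z)"
      by (simp add: a b yz tensor_add_left tensor_add_right scaleC_right_distrib)
    ultimately show ?case by blast
  qed
qed

lemma graded_eqI:
  assumes "super_space G" "clinear f" "clinear h" "\<And>i x. x \<in> G i \<Longrightarrow> f x = h x"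
  shows "f x = h x"
proof -
  obtain y z where "y \<in> G 0" "z \<in> G 1" "x = y + z" using assms(1) unfolding super_space_def by blast
  then show ?thesis by (simp add: clinear_add[OF assms(2)] clinear_add[OF assms(3)] assms(4))
qed

lemma tensor_graded_eqI:
  assumes GA: "super_space GA" and GB: "super_space GB" and f: "clinear f" "clinear h"
    and eq: "\<And>i j a b. a \<in> GA i \<Longrightarrow> b \<in> GB j \<Longrightarrow> f (a \<otimes> b) = h (a \<otimes> b)"
  shows "f t = h t"
proof (rule tensor_eqI[OF f])
  fix a b
  note L = clinear_comp[OF f(1)] clinear_comp[OF f(2)] clinear_tensor_left clinear_tensor_right clinear_ident
  show "f (a \<otimes> b) = h (a \<otimes> b)"
  proof (rule graded_eqI[OF GA, of "\<lambda>a. f (a \<otimes> b)" "\<lambda>a. h (a \<otimes> b)"])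
    fix a i assume a: "a \<in> GA i"
    show "f (a \<otimes> b) = h (a \<otimes> b)"
      by (rule graded_eqI[OF GB, of "\<lambda>b. f (a \<otimes> b)" "\<lambda>b. h (a \<otimes> b)"]) (simp_all add: eq[OF a] L)
  qed (simp_all add: L)
qed

lemma tensor_grading_in:
  assumes "clinear f" "cvs.subspace W" "t \<in> tensor_grading GA GB k"
    and "\<And>i j a b. a \<in> GA i \<Longrightarrow> b \<in> GB j \<Longrightarrow> i + j = k \<Longrightarrow> f (a \<otimes> b) \<in> W"
  shows "f t \<in> W"
proof -
  have "cvs.subspace {t. f t \<in> W}"
    using assms(2) by (simp add: cvs.subspace_def clinear_0[OF assms(1)] clinear_add[OF assms(1)] clinear_scaleC[OF assms(1)])
  then have "tensor_grading GA GB k \<subseteq> {t. f t \<in> W}"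
    unfolding tensor_grading_def by (rule cvs.span_minimal[rotated]) (use assms(4) in blast)
  then show ?thesis using assms(3) by auto
qed

lemma tensor_grading_eqI:
  assumes f: "clinear f" "clinear h" and t: "t \<in> tensor_grading GA GB k"
    and eq: "\<And>i j a b. a \<in> GA i \<Longrightarrow> b \<in> GB j \<Longrightarrow> i + j = k \<Longrightarrow> f (a \<otimes> b) = h (a \<otimes> b)"
  shows "f t = h t"
  using tensor_grading_in[OF clinear_minus[OF f] cvs.subspace_single_0 t] eq by simp

section \<open>The isomorphism from the super tensor product to the ordinary one\<close>

text \<open>
  On homogeneous \<open>b\<close> this is \<open>a \<otimes> b \<mapsto> a g\<^bsup>p(b)\<^esup> \<otimes> \<psi> b\<close>. The map \<open>\<psi>\<close> is the identity for the tensor square;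
  for the triple tensor power the second factor is itself a tensor square, and \<open>\<psi>\<close> is the map of this
  kind that removes the signs there.
\<close>

definition unbraid ::
  "'a::complex_alg_1 \<Rightarrow> 'b::complex_alg_1 \<Rightarrow> ('b \<Rightarrow> 'b) \<Rightarrow> ('a, 'b) tensor \<Rightarrow> ('a, 'b) tensor"
  where "unbraid g v \<psi> t =
    tensor_map id (\<lambda>b. \<psi> (hcomp (ad_grading v) 0 b)) t
    + tensor_map (\<lambda>a. a * g) (\<lambda>b. \<psi> (hcomp (ad_grading v) 1 b)) t"

lemma clinear_unbraid:
  assumes v: "v * v = 1" and \<psi>: "clinear \<psi>"
  shows "clinear (unbraid g v \<psi>)"
  unfolding unbraid_def
  by (simp add: clinear_intros clinear_comp[OF \<psi>] clinear_hcomp super_space_ad_grading v)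

lemma unbraid_tensor:
  assumes v: "v * v = 1" and \<psi>: "clinear \<psi>" and b: "b \<in> ad_grading v j"
  shows "unbraid g v \<psi> (a \<otimes> b) = (a * parity_pow g j) \<otimes> \<psi> b"
proof -
  note G = super_space_ad_grading[OF v]
  have L: "clinear (\<lambda>b. \<psi> (hcomp (ad_grading v) i b))" for i
    by (rule clinear_comp[OF \<psi> clinear_hcomp[OF G]])
  show ?thesis
    unfolding unbraid_def
    by (cases j; simp add: tensor_map_tensor L clinear_intros hcomp_homogeneous[OF G b]
        clinear_0[OF \<psi>] tensor_0 parity_pow_def)
qed

lemma clinear_super_tensor_mult:
  assumes "super_space GA" "super_space GB" "cbilinear mA" "cbilinear mB"
  shows "clinear (\<lambda>s. super_tensor_mult GA mA GB mB s t)" "clinear (super_tensor_mult GA mA GB mB s)"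
proof -
  have A: "clinear (\<lambda>x. mA x b)" "clinear (mA a)" and B: "clinear (\<lambda>x. mB x d)" "clinear (mB c)" for a b c d
    using assms by (simp_all add: cbilinear_def)
  note comp = clinear_comp[OF A(1)] clinear_comp[OF A(2)] clinear_comp[OF B(1)] clinear_comp[OF B(2)]
  show "clinear (\<lambda>s. super_tensor_mult GA mA GB mB s t)" "clinear (super_tensor_mult GA mA GB mB s)"
    unfolding super_tensor_mult_def
    by (simp_all add: A B comp clinear_intros clinear_hcomp assms)
qed

text \<open>
  The sign in the super product arises when \<open>g\<^bsup>p(b)\<^esup>\<close> is moved past \<open>a'\<close>.
\<close>

lemma unbraid_super_tensor_mult:
  fixes g :: "'a::complex_alg_1" and v :: "'b::complex_alg_1"
  assumes g: "g * g = 1" and v: "v * v = 1" and \<psi>: "clinear \<psi>"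
    and inv: "\<And>b. \<psi> (\<psi> b) = b" and grade: "\<And>b j. b \<in> ad_grading v j \<Longrightarrow> \<psi> b \<in> ad_grading v j"
    and mB: "\<And>b b'. mB b b' = \<psi> (\<psi> b * \<psi> b')"
  shows "unbraid g v \<psi> (super_tensor_mult (ad_grading g) (*) (ad_grading v) mB s t) =
    unbraid g v \<psi> s * unbraid g v \<psi> t"
proof -
  note Gg = super_space_ad_grading[OF g] and Gv = super_space_ad_grading[OF v]
  have mA: "cbilinear ((*) :: 'a \<Rightarrow> _)" by (simp add: clinear_intros)
  have mB': "cbilinear mB"
    by (simp add: mB clinear_intros clinear_comp[OF \<psi>] \<psi>)
  note lin = clinear_super_tensor_mult[OF Gg Gv mA mB'] clinear_unbraid[OF v \<psi>]
  note L = clinear_comp[OF clinear_unbraid[OF v \<psi>]] lin clinear_mult_left clinear_mult_right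
  have mult_in: "b * b' \<in> ad_grading v (i + j)" if "b \<in> ad_grading v i" "b' \<in> ad_grading v j" for b b' i j
    using super_algebra_ad_grading[OF v] that by (simp add: super_algebra_def)
  show ?thesis
  proof (rule tensor_graded_eqI[OF Gg Gv, of "\<lambda>s. unbraid g v \<psi> (super_tensor_mult (ad_grading g) (*) (ad_grading v) mB s t)"
        "\<lambda>s. unbraid g v \<psi> s * unbraid g v \<psi> t"])
    fix i j a b assume a: "a \<in> ad_grading g i" and b: "b \<in> ad_grading v j"
    show "unbraid g v \<psi> (super_tensor_mult (ad_grading g) (*) (ad_grading v) mB (a \<otimes> b) t) =
      unbraid g v \<psi> (a \<otimes> b) * unbraid g v \<psi> t"
    proof (rule tensor_graded_eqI[OF Gg Gv, of "\<lambda>t. unbraid g v \<psi> (super_tensor_mult (ad_grading g) (*) (ad_grading v) mB (a \<otimes> b) t)"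
        "\<lambda>t. unbraid g v \<psi> (a \<otimes> b) * unbraid g v \<psi> t"])
      fix k l a' b' assume a': "a' \<in> ad_grading g k" and b': "b' \<in> ad_grading v l"
      have bb': "mB b b' \<in> ad_grading v (j + l)"
        unfolding mB by (intro grade mult_in b b')
      have "unbraid g v \<psi> (super_tensor_mult (ad_grading g) (*) (ad_grading v) mB (a \<otimes> b) (a' \<otimes> b')) =
        sign (k * j) *\<^sub>C ((a * a' * parity_pow g (j + l)) \<otimes> (\<psi> b * \<psi> b'))"
        using unbraid_tensor[OF v \<psi> bb', of g]
        by (simp add: super_tensor_mult_homogeneous[OF Gg Gv mA mB' a' b] clinear_scaleC[OF lin(3)] mB inv)
      also have "\<dots> = (a * (parity_pow g j * a') * parity_pow g l) \<otimes> (\<psi> b * \<psi> b')"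
        by (simp add: parity_pow_commute[OF g a'] mult.commute[of k j] mult_scaleC_left mult_scaleC_right
            tensor_scaleC_left mult.assoc parity_pow_add[OF g])
      also have "\<dots> = unbraid g v \<psi> (a \<otimes> b) * unbraid g v \<psi> (a' \<otimes> b')"
        by (simp add: unbraid_tensor[OF v \<psi> b] unbraid_tensor[OF v \<psi> b'] tensor_times mult.assoc)
      finally show "unbraid g v \<psi> (super_tensor_mult (ad_grading g) (*) (ad_grading v) mB (a \<otimes> b) (a' \<otimes> b'))
        = unbraid g v \<psi> (a \<otimes> b) * unbraid g v \<psi> (a' \<otimes> b')" .
    qed (simp_all add: L)
  qed (simp_all add: L)
qed

lemma unbraid_unbraid:
  assumes g: "g * g = 1" and v: "v * v = 1" and \<psi>: "clinear \<psi>"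
    and inv: "\<And>b. \<psi> (\<psi> b) = b" and grade: "\<And>b j. b \<in> ad_grading v j \<Longrightarrow> \<psi> b \<in> ad_grading v j"
  shows "unbraid g v \<psi> (unbraid g v \<psi> t) = t"
proof (rule tensor_graded_eqI[OF super_space_ad_grading[OF g] super_space_ad_grading[OF v], 
      of "\<lambda>t. unbraid g v \<psi> (unbraid g v \<psi> t)" "\<lambda>t. t"])
  fix i j a b assume b: "b \<in> ad_grading v j"
  show "unbraid g v \<psi> (unbraid g v \<psi> (a \<otimes> b)) = a \<otimes> b"
    unfolding unbraid_tensor[OF v \<psi> b] unbraid_tensor[OF v \<psi> grade[OF b]]
    by (cases j) (simp_all add: inv mult.assoc g parity_pow_def)
qed (simp_all add: clinear_comp clinear_unbraid v \<psi> clinear_ident)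

lemma unbraid_grade:
  assumes g: "g * g = 1" and v: "v * v = 1" and \<psi>: "clinear \<psi>"
    and grade: "\<And>b j. b \<in> ad_grading v j \<Longrightarrow> \<psi> b \<in> ad_grading v j"
    and t: "t \<in> ad_grading (g \<otimes> v) k"
  shows "unbraid g v \<psi> t \<in> ad_grading (g \<otimes> v) k"
proof (rule tensor_grading_in[where f = "unbraid g v \<psi>"])
  have gv: "(g \<otimes> v) * (g \<otimes> v) = 1" by (simp add: tensor_times g v one_tensor_def)
  show "t \<in> tensor_grading (ad_grading g) (ad_grading v) k"
    by (simp add: tensor_grading_ad_grading g v t)
  show "cvs.subspace (ad_grading (g \<otimes> v) k)" by (rule subspace_ad_grading[OF gv])
  show "clinear (unbraid g v \<psi>)" by (rule clinear_unbraid[OF v \<psi>])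
  fix i j a b assume a: "a \<in> ad_grading g i" and b: "b \<in> ad_grading v j" and "i + j = k"
  have "g * (a * parity_pow g j) = sign i *\<^sub>C (a * parity_pow g j * g)"
    using a g by (cases j; simp add: ad_grading_iff parity_pow_def mult.assoc[symmetric] mult_scaleC_left)
  moreover have "v * \<psi> b = sign j *\<^sub>C (\<psi> b * v)"
    using grade[OF b] v by (simp add: ad_grading_iff)
  ultimately show "unbraid g v \<psi> (a \<otimes> b) \<in> ad_grading (g \<otimes> v) k"
    unfolding \<open>i + j = k\<close>[symmetric] ad_grading_iff[OF gv] sign_add[symmetric]
    by (simp add: unbraid_tensor[OF v \<psi> b] tensor_times tensor_scaleC_left
        tensor_scaleC_right scaleC_scaleC mult.commute)
qed

section \<open>Twisting an ordinary Hopf algebra\<close>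

lemma tensor_assoc_mult: "tensor_assoc (s * t) = tensor_assoc s * tensor_assoc t"
  for s t :: "(('a::complex_alg_1, 'b::complex_alg_1) tensor, 'c::complex_alg_1) tensor"
proof (rule tensor_eqI[of "\<lambda>s. tensor_assoc (s * t)" "\<lambda>s. tensor_assoc s * tensor_assoc t"])
  fix r :: "('a, 'b) tensor" and c :: 'c
  note L = clinear_intros clinear_tensor_assoc
  show "tensor_assoc ((r \<otimes> c) * t) = tensor_assoc (r \<otimes> c) * tensor_assoc t"
  proof (rule tensor_eqI[of "\<lambda>t. tensor_assoc ((r \<otimes> c) * t)" "\<lambda>t. tensor_assoc (r \<otimes> c) * tensor_assoc t"])
    fix r' :: "('a, 'b) tensor" and c' :: 'c
    show "tensor_assoc ((r \<otimes> c) * (r' \<otimes> c')) = tensor_assoc (r \<otimes> c) * tensor_assoc (r' \<otimes> c')"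
    proof (rule tensor_eqI[of "\<lambda>r. tensor_assoc ((r \<otimes> c) * (r' \<otimes> c'))" "\<lambda>r. tensor_assoc (r \<otimes> c) * tensor_assoc (r' \<otimes> c')"])
      fix a b
      show "tensor_assoc (((a \<otimes> b) \<otimes> c) * (r' \<otimes> c')) = tensor_assoc ((a \<otimes> b) \<otimes> c) * tensor_assoc (r' \<otimes> c')"
        by (rule tensor_eqI[of "\<lambda>r'. tensor_assoc (((a \<otimes> b) \<otimes> c) * (r' \<otimes> c'))"])
          (simp_all add: L tensor_times tensor_assoc_tensor tensor_lift_tensor)
    qed (simp_all add: L)
  qed (simp_all add: L)
qed (simp_all add: clinear_intros clinear_tensor_assoc)

lemmas one_tensor = one_tensor_def[symmetric]

lemma tensor_assoc_one: "tensor_assoc 1 = 1"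
  by (simp add: one_tensor_def tensor_assoc_tensor tensor_lift_tensor clinear_intros)

lemma tensor_map_mult:
  fixes s t :: "('a::complex_alg_1, 'b::complex_alg_1) tensor"
    and f :: "'a \<Rightarrow> 'c::complex_alg_1" and h :: "'b \<Rightarrow> 'd::complex_alg_1"
  assumes f: "clinear f" "\<And>x y. f (x * y) = f x * f y" and h: "clinear h" "\<And>x y. h (x * y) = h x * h y"
  shows "tensor_map f h (s * t) = tensor_map f h s * tensor_map f h t"
proof (rule tensor_eqI[of "\<lambda>s. tensor_map f h (s * t)" "\<lambda>s. tensor_map f h s * tensor_map f h t"])
  note L = clinear_intros f(1) h(1)
  fix a b
  show "tensor_map f h ((a \<otimes> b) * t) = tensor_map f h (a \<otimes> b) * tensor_map f h t"
    by (rule tensor_eqI[of "\<lambda>t. tensor_map f h ((a \<otimes> b) * t)"])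
      (simp_all add: L tensor_times tensor_map_tensor f(2) h(2))
qed (simp_all add: clinear_intros f(1) h(1))

text \<open>
  Both antipode axioms of a twisted Hopf algebra insert an element between the antipode and the
  identity, hence the additional argument \<open>x\<close>; for \<open>x = 1\<close> these are the convolutions of the antipode
  with the identity.
\<close>

definition left_sandwich ::
  "('a::complex_alg_1 \<Rightarrow> 'a) \<Rightarrow> 'a \<Rightarrow> ('a, 'a) tensor \<Rightarrow> 'a"
  where "left_sandwich S x t = tensor_lift (\<lambda>a b. S a * x * b) t"

definition right_sandwich ::
  "('a::complex_alg_1 \<Rightarrow> 'a) \<Rightarrow> 'a \<Rightarrow> ('a, 'a) tensor \<Rightarrow> 'a"
  where "right_sandwich S x t = tensor_lift (\<lambda>a b. a * x * S b) t"

locale hopf =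
  fixes A :: "'a::complex_alg_1 hopf_data"
  assumes hopf: "hopf_algebra A"
begin

abbreviation "D \<equiv> comult A"
abbreviation "e \<equiv> counit A"
abbreviation "S \<equiv> antipode A"
abbreviation "\<Lambda> \<equiv> left_sandwich S"
abbreviation "\<Gamma> \<equiv> right_sandwich S"

lemmas ax = hopf[unfolded hopf_algebra_def hopf_axioms_def mult2_eq one_tensor]

lemma clinear_D: "clinear D" and clinear_e: "clinear e" and clinear_S: "clinear S"
  using ax by blast+

lemmas lin = clinear_intros clinear_tensor_assoc clinear_D clinear_e clinear_S
  clinear_comp[OF clinear_D] clinear_comp[OF clinear_e] clinear_comp[OF clinear_S]

lemma D_mult: "D (x * y) = D x * D y" and D_one: "D 1 = 1"
  and e_mult: "e (x * y) = e x * e y" and e_one: "e 1 = 1"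
  and coassoc: "tensor_assoc (tensor_map D id (D x)) = tensor_map id D (D x)"
  and counit_left: "tensor_lift (\<lambda>a b. e a *\<^sub>C b) (D x) = x"
  and counit_right: "tensor_lift (\<lambda>a b. e b *\<^sub>C a) (D x) = x"
  and antipode_left: "\<Lambda> 1 (D x) = e x *\<^sub>C 1"
  and antipode_right: "\<Gamma> 1 (D x) = e x *\<^sub>C 1"
  using ax by (auto simp: left_sandwich_def right_sandwich_def)

lemma clinear_sandwich:
  "clinear f \<Longrightarrow> clinear (\<lambda>y. \<Lambda> x (f y))" "clinear f \<Longrightarrow> clinear (\<lambda>y. \<Gamma> x (f y))"
  "clinear h \<Longrightarrow> clinear (\<lambda>y. \<Lambda> (h y) t)" "clinear h \<Longrightarrow> clinear (\<lambda>y. \<Gamma> (h y) t)"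
  unfolding left_sandwich_def right_sandwich_def by (simp_all add: lin)

lemma sandwich_tensor:
  "\<Lambda> x (a \<otimes> b) = S a * x * b" "\<Gamma> x (a \<otimes> b) = a * x * S b"
  unfolding left_sandwich_def right_sandwich_def by (simp_all add: lin tensor_lift_tensor)

lemmas Lin = lin clinear_sandwich

text \<open>
  The antipode is anti-multiplicative: evaluate \<open>S(x\<^sub>1 y\<^sub>1) x\<^sub>2 y\<^sub>2 S(y\<^sub>3) S(x\<^sub>3)\<close> in two ways.
  Contracting the first two legs gives \<open>S(y) S(x)\<close>, contracting the last two gives \<open>S(x y)\<close>.
\<close>

lemma S_mult: "S (x * y) = S y * S x"
proof -
  define B where "B t u =
    tensor_lift (\<lambda>a r. tensor_lift (\<lambda>b c. tensor_lift (\<lambda>a' r'. tensor_lift (\<lambda>b' c'.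
      S (a * a') * b * b' * S c' * S c) r') u) r) t" for t u
  have B: "B (a \<otimes> (b \<otimes> c)) (a' \<otimes> (b' \<otimes> c')) = S (a * a') * b * b' * S c' * S c" for a b c a' b' c'
    unfolding B_def by (simp add: lin tensor_lift_tensor)
  have Blin0: "clinear (\<lambda>t. B t u)" "clinear (\<lambda>u. B t u)" for t u
    unfolding B_def by (simp_all add: lin)
  note Blin = clinear_comp[OF Blin0(1)] clinear_comp[OF Blin0(2)]
  have B1: "B (tensor_assoc (s \<otimes> c)) (tensor_assoc (s' \<otimes> c')) = \<Lambda> 1 (s * s') * S c' * S c" for s s' c c'
  proof (rule tensor_eqI[of "\<lambda>s. B (tensor_assoc (s \<otimes> c)) (tensor_assoc (s' \<otimes> c'))" "\<lambda>s. \<Lambda> 1 (s * s') * S c' * S c"])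
    fix a b
    show "B (tensor_assoc ((a \<otimes> b) \<otimes> c)) (tensor_assoc (s' \<otimes> c')) = \<Lambda> 1 ((a \<otimes> b) * s') * S c' * S c"
      by (rule tensor_eqI[of "\<lambda>s'. B (tensor_assoc ((a \<otimes> b) \<otimes> c)) (tensor_assoc (s' \<otimes> c'))"])
        (simp_all add: Lin Blin tensor_assoc_tensor tensor_lift_tensor B tensor_times sandwich_tensor mult.assoc)
  qed (simp_all add: Lin Blin)
  have B2: "B (a \<otimes> r) (a' \<otimes> r') = S (a * a') * \<Gamma> (\<Gamma> 1 r') r" for a a' r r'
  proof (rule tensor_eqI[of "\<lambda>r. B (a \<otimes> r) (a' \<otimes> r')" "\<lambda>r. S (a * a') * \<Gamma> (\<Gamma> 1 r') r"])
    fix b c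
    show "B (a \<otimes> (b \<otimes> c)) (a' \<otimes> r') = S (a * a') * \<Gamma> (\<Gamma> 1 r') (b \<otimes> c)"
      by (rule tensor_eqI[of "\<lambda>r'. B (a \<otimes> (b \<otimes> c)) (a' \<otimes> r')"])
        (simp_all add: Lin Blin B sandwich_tensor mult.assoc)
  qed (simp_all add: Lin Blin)
  let ?l = "tensor_lift (\<lambda>a b. e a *\<^sub>C b)" and ?r = "tensor_lift (\<lambda>a b. e b *\<^sub>C a)"
  have l: "B (tensor_assoc (tensor_map D id t)) (tensor_assoc (tensor_map D id u)) = S (?l u) * S (?l t)" for t u
  proof (rule tensor_eqI[of "\<lambda>t. B (tensor_assoc (tensor_map D id t)) (tensor_assoc (tensor_map D id u))" "\<lambda>t. S (?l u) * S (?l t)"])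
    fix a b
    show "B (tensor_assoc (tensor_map D id (a \<otimes> b))) (tensor_assoc (tensor_map D id u)) = S (?l u) * S (?l (a \<otimes> b))"
      by (rule tensor_eqI[of "\<lambda>u. B (tensor_assoc (tensor_map D id (a \<otimes> b))) (tensor_assoc (tensor_map D id u))"])
        (simp_all add: Lin Blin tensor_map_tensor tensor_lift_tensor B1 antipode_left e_mult
            clinear_scaleC[OF clinear_S] mult_scaleC_left mult_scaleC_right scaleC_scaleC mult.commute
          flip: D_mult)
  qed (simp_all add: Lin Blin)
  have r: "B (tensor_map id D t) (tensor_map id D u) = S (?r t * ?r u)" for t u
  proof (rule tensor_eqI[of "\<lambda>t. B (tensor_map id D t) (tensor_map id D u)" "\<lambda>t. S (?r t * ?r u)"])
    fix a b
    show "B (tensor_map id D (a \<otimes> b)) (tensor_map id D u) = S (?r (a \<otimes> b) * ?r u)"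
      by (rule tensor_eqI[of "\<lambda>u. B (tensor_map id D (a \<otimes> b)) (tensor_map id D u)"])
        (simp_all add: Lin Blin tensor_map_tensor tensor_lift_tensor B2 antipode_right
            clinear_scaleC[OF clinear_S] clinear_scaleC[OF clinear_sandwich(4)[OF clinear_ident(1)]]
            mult_scaleC_left mult_scaleC_right scaleC_scaleC mult.commute)
  qed (simp_all add: Lin Blin)
  show ?thesis
    using l[of "D x" "D y"] r[of "D x" "D y"] by (simp add: coassoc counit_left counit_right)
qed

lemma S_one: "S 1 = 1"
  using antipode_left[of 1] by (simp add: D_one one_tensor_def sandwich_tensor e_one scaleC_one)

text \<open>
  Anti-multiplicativity makes the sandwich maps a right and a left action of the tensor square; this
  reduces the antipode axioms for the twisted coproduct to those for the original one.
\<close>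

lemma \<Lambda>_mult: "\<Lambda> x (s * t) = \<Lambda> (\<Lambda> x s) t"
proof (rule tensor_eqI[of "\<lambda>s. \<Lambda> x (s * t)" "\<lambda>s. \<Lambda> (\<Lambda> x s) t"])
  fix a b
  show "\<Lambda> x ((a \<otimes> b) * t) = \<Lambda> (\<Lambda> x (a \<otimes> b)) t"
    by (rule tensor_eqI[of "\<lambda>t. \<Lambda> x ((a \<otimes> b) * t)"])
      (simp_all add: Lin tensor_times sandwich_tensor S_mult mult.assoc)
qed (simp_all add: Lin)

lemma \<Gamma>_mult: "\<Gamma> x (s * t) = \<Gamma> (\<Gamma> x t) s"
proof (rule tensor_eqI[of "\<lambda>s. \<Gamma> x (s * t)" "\<lambda>s. \<Gamma> (\<Gamma> x t) s"])
  fix a b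
  show "\<Gamma> x ((a \<otimes> b) * t) = \<Gamma> (\<Gamma> x t) (a \<otimes> b)"
    by (rule tensor_eqI[of "\<lambda>t. \<Gamma> x ((a \<otimes> b) * t)"])
      (simp_all add: Lin tensor_times sandwich_tensor S_mult mult.assoc)
qed (simp_all add: Lin)

abbreviation "Dl t \<equiv> tensor_assoc (tensor_map D id t)"
abbreviation "Dr t \<equiv> tensor_map id D t"
abbreviation "El \<equiv> tensor_lift (\<lambda>a b. e a *\<^sub>C b)"
abbreviation "Er \<equiv> tensor_lift (\<lambda>a b. e b *\<^sub>C a)"

lemma El_mult: "El (s * t) = El s * El t"
proof (rule tensor_eqI[of "\<lambda>s. El (s * t)" "\<lambda>s. El s * El t"])
  fix a b
  show "El ((a \<otimes> b) * t) = El (a \<otimes> b) * El t"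
    by (rule tensor_eqI[of "\<lambda>t. El ((a \<otimes> b) * t)"])
      (simp_all add: Lin tensor_times tensor_lift_tensor e_mult mult_scaleC_left mult_scaleC_right scaleC_scaleC)
qed (simp_all add: Lin)

lemma Er_mult: "Er (s * t) = Er s * Er t"
proof (rule tensor_eqI[of "\<lambda>s. Er (s * t)" "\<lambda>s. Er s * Er t"])
  fix a b
  show "Er ((a \<otimes> b) * t) = Er (a \<otimes> b) * Er t"
    by (rule tensor_eqI[of "\<lambda>t. Er ((a \<otimes> b) * t)"])
      (simp_all add: Lin tensor_times tensor_lift_tensor e_mult mult_scaleC_left mult_scaleC_right scaleC_scaleC)
qed (simp_all add: Lin)

lemma El_one: "El 1 = 1" and Er_one: "Er 1 = 1"
  by (simp_all add: one_tensor_def tensor_lift_tensor Lin e_one scaleC_one)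

lemma Dl_mult: "Dl (s * t) = Dl s * Dl t" and Dr_mult: "Dr (s * t) = Dr s * Dr t"
  by (simp_all add: tensor_map_mult Lin D_mult tensor_assoc_mult)

lemma Dl_one: "Dl 1 = 1" and Dr_one: "Dr 1 = 1"
  by (simp_all add: one_tensor_def tensor_map_tensor Lin D_one)
    (simp_all add: one_tensor tensor_assoc_one)

end

locale hopf_twist = hopf +
  fixes J K :: "('a, 'a) tensor"
  assumes JK: "J * K = 1" and KJ: "K * J = 1"
    and cocycle: "Dl J * tensor_assoc (J \<otimes> 1) = Dr J * (1 \<otimes> J)"
    and El_J: "El J = 1" and Er_J: "Er J = 1"
begin

lemma El_K: "El K = 1" and Er_K: "Er K = 1"
  using El_mult[of J K] Er_mult[of J K] by (simp_all add: JK El_J Er_J El_one Er_one)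

lemma cancel: "J * (K * t) = t" "K * (J * t) = t"
  by (simp_all add: JK KJ flip: mult.assoc)

lemma one_invs:
  "tensor_assoc (J \<otimes> 1) * tensor_assoc (K \<otimes> 1) = 1" "tensor_assoc (K \<otimes> 1) * tensor_assoc (J \<otimes> 1) = 1"
  "(1 \<otimes> J) * (1 \<otimes> K) = 1" "(1 \<otimes> K) * (1 \<otimes> J) = 1"
  by (simp_all add: tensor_times JK KJ one_tensor tensor_assoc_one flip: tensor_assoc_mult)

lemma Dl_Dr_invs: "Dl J * Dl K = 1" "Dl K * Dl J = 1" "Dr J * Dr K = 1" "Dr K * Dr J = 1"
  by (simp_all only: JK KJ Dl_one Dr_one flip: Dl_mult Dr_mult)

lemmas invs = one_invs Dl_Dr_invs

text \<open>
  Moving one factor across on each side brings \<open>J\<close> and its inverse \<open>K\<close> together, in the form from which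
  the products \<open>Q Q'\<close> and \<open>Q' Q\<close> below arise.
\<close>

lemma cocycle_mixed: "tensor_assoc (J \<otimes> 1) * (1 \<otimes> K) = Dl K * Dr J"
  "(1 \<otimes> J) * tensor_assoc (K \<otimes> 1) = Dr K * Dl J"
proof -
  have "Dl K * (Dl J * tensor_assoc (J \<otimes> 1)) * (1 \<otimes> K) = Dl K * (Dr J * (1 \<otimes> J)) * (1 \<otimes> K)"
    by (simp only: cocycle)
  then show "tensor_assoc (J \<otimes> 1) * (1 \<otimes> K) = Dl K * Dr J"
    by (simp add: mult.assoc invs) (simp add: invs flip: mult.assoc)
  have "Dr K * (Dl J * tensor_assoc (J \<otimes> 1)) * tensor_assoc (K \<otimes> 1) = Dr K * (Dr J * (1 \<otimes> J)) * tensor_assoc (K \<otimes> 1)"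
    by (simp only: cocycle)
  then show "(1 \<otimes> J) * tensor_assoc (K \<otimes> 1) = Dr K * Dl J"
    by (simp add: mult.assoc invs) (simp add: invs flip: mult.assoc)
qed

lemma cocycle_inverse: "tensor_assoc (K \<otimes> 1) * Dl K = (1 \<otimes> K) * Dr K"
proof -
  have "(1 \<otimes> K) * Dr K * (Dl J * tensor_assoc (J \<otimes> 1)) * tensor_assoc (K \<otimes> 1) * Dl K =
    (1 \<otimes> K) * Dr K * (Dr J * (1 \<otimes> J)) * tensor_assoc (K \<otimes> 1) * Dl K"
    by (simp only: cocycle)
  moreover have "(1 \<otimes> K) * Dr K * (Dl J * tensor_assoc (J \<otimes> 1)) * tensor_assoc (K \<otimes> 1) * Dl K =
    (1 \<otimes> K) * Dr K * (Dl J * (tensor_assoc (J \<otimes> 1) * tensor_assoc (K \<otimes> 1)) * Dl K)"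
    by (simp only: mult.assoc)
  moreover have "(1 \<otimes> K) * Dr K * (Dr J * (1 \<otimes> J)) * tensor_assoc (K \<otimes> 1) * Dl K =
    (1 \<otimes> K) * (Dr K * Dr J) * (1 \<otimes> J) * (tensor_assoc (K \<otimes> 1) * Dl K)"
    by (simp only: mult.assoc)
  ultimately show ?thesis by (simp add: invs)
qed

text \<open>
  Explicitly, \<open>Q = S(J\<^sub>1) J\<^sub>2\<close> and \<open>Q' = K\<^sub>1 S(K\<^sub>2)\<close> in Sweedler notation.
\<close>

definition "Q = \<Lambda> 1 J"
definition "Q' = \<Gamma> 1 K"

text \<open>
  Applying \<open>a \<otimes> b \<otimes> c \<mapsto> S(a) b S(c)\<close> to the first identity of \<open>cocycle_mixed\<close> gives \<open>Q Q'\<close> on the left.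
  On the right the antipode axioms turn all coproducts into counits, and the counit
  conditions on \<open>J\<close> and \<open>K\<close> leave \<open>1\<close>.
\<close>

lemma Q_Q': "Q * Q' = 1"
proof -
  define B where "B t = tensor_lift (\<lambda>a r. tensor_lift (\<lambda>b c. S a * b * S c) r) t" for t
  have B: "B (a \<otimes> (b \<otimes> c)) = S a * b * S c" for a b c
    unfolding B_def by (simp add: lin tensor_lift_tensor)
  have "clinear B" unfolding B_def by (simp add: lin)
  note L = Lin clinear_comp[OF this] and T = tensor_assoc_tensor tensor_lift_tensor tensor_times sandwich_tensor
  have 1: "B (tensor_assoc (s \<otimes> 1) * (1 \<otimes> t)) = \<Lambda> 1 s * \<Gamma> 1 t" for s t
  proof (rule tensor_eqI[of "\<lambda>s. B (tensor_assoc (s \<otimes> 1) * (1 \<otimes> t))" "\<lambda>s. \<Lambda> 1 s * \<Gamma> 1 t"])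
    fix a b
    show "B (tensor_assoc ((a \<otimes> b) \<otimes> 1) * (1 \<otimes> t)) = \<Lambda> 1 (a \<otimes> b) * \<Gamma> 1 t"
      by (rule tensor_eqI[of "\<lambda>t. B (tensor_assoc ((a \<otimes> b) \<otimes> 1) * (1 \<otimes> t))"])
        (simp_all add: L T B mult.assoc)
  qed (simp_all add: L)
  have 2: "B (tensor_assoc (x \<otimes> b) * (c \<otimes> y)) = S c * \<Lambda> 1 x * \<Gamma> 1 y * S b" for x y b c
  proof (rule tensor_eqI[of "\<lambda>x. B (tensor_assoc (x \<otimes> b) * (c \<otimes> y))" "\<lambda>x. S c * \<Lambda> 1 x * \<Gamma> 1 y * S b"])
    fix p q
    show "B (tensor_assoc ((p \<otimes> q) \<otimes> b) * (c \<otimes> y)) = S c * \<Lambda> 1 (p \<otimes> q) * \<Gamma> 1 y * S b"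
      by (rule tensor_eqI[of "\<lambda>y. B (tensor_assoc ((p \<otimes> q) \<otimes> b) * (c \<otimes> y))"])
        (simp_all add: L T B S_mult mult.assoc)
  qed (simp_all add: L)
  have 3: "B (Dl s * Dr t) = S (Er t) * S (El s)" for s t
  proof (rule tensor_eqI[of "\<lambda>s. B (Dl s * Dr t)" "\<lambda>s. S (Er t) * S (El s)"])
    fix a b
    show "B (Dl (a \<otimes> b) * Dr t) = S (Er t) * S (El (a \<otimes> b))"
      by (rule tensor_eqI[of "\<lambda>t. B (Dl (a \<otimes> b) * Dr t)"])
        (simp_all add: L tensor_map_tensor tensor_lift_tensor 2 antipode_left antipode_right
          clinear_scaleC[OF clinear_S] mult_scaleC_left mult_scaleC_right scaleC_scaleC mult.commute)
  qed (simp_all add: L)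
  show ?thesis
    using 1[of J K] 3[of K J] by (simp add: cocycle_mixed Q_def Q'_def Er_J El_K S_one)
qed

text \<open>
  The same argument with \<open>a \<otimes> b \<otimes> c \<mapsto> a S(b) c\<close> and the second identity.
\<close>

lemma Q'_Q: "Q' * Q = 1"
proof -
  define B where "B t = tensor_lift (\<lambda>a r. tensor_lift (\<lambda>b c. a * S b * c) r) t" for t
  have B: "B (a \<otimes> (b \<otimes> c)) = a * S b * c" for a b c
    unfolding B_def by (simp add: lin tensor_lift_tensor)
  have "clinear B" unfolding B_def by (simp add: lin)
  note L = Lin clinear_comp[OF this] and T = tensor_assoc_tensor tensor_lift_tensor tensor_times sandwich_tensor
  have 1: "B ((1 \<otimes> t) * tensor_assoc (s \<otimes> 1)) = \<Gamma> 1 s * \<Lambda> 1 t" for s t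
  proof (rule tensor_eqI[of "\<lambda>s. B ((1 \<otimes> t) * tensor_assoc (s \<otimes> 1))" "\<lambda>s. \<Gamma> 1 s * \<Lambda> 1 t"])
    fix a b
    show "B ((1 \<otimes> t) * tensor_assoc ((a \<otimes> b) \<otimes> 1)) = \<Gamma> 1 (a \<otimes> b) * \<Lambda> 1 t"
      by (rule tensor_eqI[of "\<lambda>t. B ((1 \<otimes> t) * tensor_assoc ((a \<otimes> b) \<otimes> 1))"])
        (simp_all add: L T B S_mult mult.assoc)
  qed (simp_all add: L)
  have 2: "B ((c \<otimes> y) * tensor_assoc (x \<otimes> b)) = c * \<Gamma> 1 x * \<Lambda> 1 y * b" for x y b c
  proof (rule tensor_eqI[of "\<lambda>x. B ((c \<otimes> y) * tensor_assoc (x \<otimes> b))" "\<lambda>x. c * \<Gamma> 1 x * \<Lambda> 1 y * b"])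
    fix p q
    show "B ((c \<otimes> y) * tensor_assoc ((p \<otimes> q) \<otimes> b)) = c * \<Gamma> 1 (p \<otimes> q) * \<Lambda> 1 y * b"
      by (rule tensor_eqI[of "\<lambda>y. B ((c \<otimes> y) * tensor_assoc ((p \<otimes> q) \<otimes> b))"])
        (simp_all add: L T B S_mult mult.assoc)
  qed (simp_all add: L)
  have 3: "B (Dr s * Dl t) = Er s * El t" for s t
  proof (rule tensor_eqI[of "\<lambda>s. B (Dr s * Dl t)" "\<lambda>s. Er s * El t"])
    fix a b
    show "B (Dr (a \<otimes> b) * Dl t) = Er (a \<otimes> b) * El t"
      by (rule tensor_eqI[of "\<lambda>t. B (Dr (a \<otimes> b) * Dl t)"])
        (simp_all add: L tensor_map_tensor tensor_lift_tensor 2 antipode_left antipode_right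
          clinear_scaleC[OF clinear_S] mult_scaleC_left mult_scaleC_right scaleC_scaleC mult.commute)
  qed (simp_all add: L)
  show ?thesis
    using 1[of J K] 3[of K J] by (simp add: cocycle_mixed Q_def Q'_def El_J Er_K)
qed

lemma twist_Q_eq: "twist_Q A J = Q"
  by (simp add: twist_Q_def Q_def left_sandwich_def)

lemma ring_inv_Q: "ring_inv Q = Q'"
  by (rule inverse_wrt_unique[OF Q_Q' Q'_Q])

lemma twisted_simps:
  "comult (twisted A J) a = K * D a * J" "counit (twisted A J) = e"
  "antipode (twisted A J) a = Q' * S a * Q"
  by (simp_all add: twisted_def twisted_wrt_def twist_Q_eq ring_inv_Q mult2_eq one_tensor inverse_wrt_unique[OF JK KJ])

lemma sandwich_scaleC: "\<Lambda> (c *\<^sub>C x) t = c *\<^sub>C \<Lambda> x t" "\<Gamma> (c *\<^sub>C x) t = c *\<^sub>C \<Gamma> x t"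
  by (rule clinear_scaleC, rule clinear_sandwich, rule clinear_ident)+

text \<open>
  Coassociativity is the twist equation for \<open>J\<close> on the right of the iterated coproduct and its inverse
  on the left. For the antipode, the action property moves \<open>J\<close> cyclically around the
  sandwich, where it cancels its inverse.
\<close>

lemma hopf_algebra_twisted: "hopf_algebra (twisted A J)"
proof -
  let ?D = "\<lambda>a. K * D a * J" and ?S = "\<lambda>a. Q' * S a * Q"
  have lD: "clinear ?D" and lS: "clinear ?S" by (simp_all add: lin)
  have l: "tensor_map ?D id t = (K \<otimes> 1) * tensor_map D id t * (J \<otimes> 1)" for t
    by (rule tensor_eqI[of "tensor_map ?D id"]) (simp_all add: lin lD tensor_map_tensor tensor_times)
  have r: "tensor_map id ?D t = (1 \<otimes> K) * tensor_map id D t * (1 \<otimes> J)" for t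
    by (rule tensor_eqI[of "tensor_map id ?D"]) (simp_all add: lin lD tensor_map_tensor tensor_times)
  have coassoc': "tensor_assoc (tensor_map ?D id (?D x)) = tensor_map id ?D (?D x)" for x
  proof -
    have "tensor_assoc (tensor_map ?D id (?D x)) =
        (tensor_assoc (K \<otimes> 1) * Dl K) * Dl (D x) * (Dl J * tensor_assoc (J \<otimes> 1))"
      unfolding l by (simp add: tensor_assoc_mult Dl_mult mult.assoc)
    also have "\<dots> = tensor_map id ?D (?D x)"
      unfolding cocycle_inverse cocycle coassoc r by (simp add: Dr_mult mult.assoc)
    finally show ?thesis .
  qed
  have SL: "tensor_lift (\<lambda>a b. ?S a * b) t = Q' * \<Lambda> Q t" for t
    by (rule tensor_eqI[of "tensor_lift (\<lambda>a b. ?S a * b)"])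
      (simp_all add: Lin tensor_lift_tensor sandwich_tensor mult.assoc)
  have SR: "tensor_lift (\<lambda>a b. a * ?S b) t = \<Gamma> Q' t * Q" for t
    by (rule tensor_eqI[of "tensor_lift (\<lambda>a b. a * ?S b)"])
      (simp_all add: Lin tensor_lift_tensor sandwich_tensor mult.assoc)
  have "\<Lambda> Q (?D x) = \<Lambda> 1 (J * (?D x))" for x by (simp add: \<Lambda>_mult Q_def)
  then have "\<Lambda> Q (?D x) = \<Lambda> 1 (D x * J)" for x by (simp add: mult.assoc cancel)
  \<comment> \<open>\<open>Q\<close> is \<open>\<Lambda> 1 J\<close>, so \<open>J\<close> enters on the left of \<open>K\<close> and cancels it\<close>
  then have left: "\<Lambda> Q (?D x) = e x *\<^sub>C Q" for x
    by (simp add: \<Lambda>_mult antipode_left sandwich_scaleC Q_def)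
  have "\<Gamma> Q' (?D x) = \<Gamma> 1 (?D x * K)" for x by (simp add: \<Gamma>_mult Q'_def)
  then have "\<Gamma> Q' (?D x) = \<Gamma> 1 (K * D x)" for x by (simp add: mult.assoc JK)
  then have right: "\<Gamma> Q' (?D x) = e x *\<^sub>C Q'" for x
    by (simp add: \<Gamma>_mult antipode_right sandwich_scaleC Q'_def)
  have counit: "El (?D x) = x" "Er (?D x) = x" for x
    by (simp_all add: El_mult Er_mult El_J Er_J El_K Er_K counit_left counit_right)
  have mult: "?D (x * y) = ?D x * ?D y" for x y by (simp add: D_mult mult.assoc cancel)
  have one: "?D 1 = 1" by (simp add: D_one KJ)
  have eqs: "comult (twisted A J) = ?D" "antipode (twisted A J) = ?S"
    by (auto simp: twisted_simps)
  show ?thesis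
    unfolding hopf_algebra_def hopf_axioms_def mult2_eq one_tensor eqs twisted_simps(2) SL SR left right
    using lD lS clinear_e coassoc' counit one mult e_mult e_one
    by (simp add: mult_scaleC_left mult_scaleC_right Q'_Q)
qed

end

section \<open>Passing between Hopf algebras and Hopf superalgebras\<close>

lemma tensor_minus_left: "(- a) \<otimes> b = - (a \<otimes> (b::'b::complex_vec))" for a :: "'a::complex_vec"
  using tensor_add_left[of "-a" a b] by (simp add: tensor_0 eq_neg_iff_add_eq_0)

lemma ad_grading_commute: "g * g = 1 \<Longrightarrow> x \<in> ad_grading g i \<Longrightarrow> g * x = sign i *\<^sub>C (x * g)"
  by (simp add: ad_grading_iff)

locale parity_element =
  fixes g :: "'a::complex_alg_1"
  assumes gg: "g * g = 1"
begin

abbreviation "G \<equiv> ad_grading g"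
definition "\<phi> = unbraid g g id"

text \<open>
  On the triple tensor power, \<open>a \<otimes> b \<otimes> c \<mapsto> a g\<^bsup>p(b)+p(c)\<^esup> \<otimes> b g\<^bsup>p(c)\<^esup> \<otimes> c\<close>.
\<close>

definition "\<phi>3 = unbraid g (g \<otimes> g) \<phi>"

lemma gg2: "(g \<otimes> g) * (g \<otimes> g) = 1"
  by (simp add: tensor_times gg one_tensor)

lemma tensor_grading_G: "tensor_grading G G = ad_grading (g \<otimes> g)"
  by (rule tensor_grading_ad_grading[OF gg gg])

lemmas space_G = super_space_ad_grading[OF gg]

lemma g_even: "g \<in> G 0" and one_even: "1 \<in> G 0"
  by (simp_all add: ad_grading_0_iff gg)

lemma G_mult: "x \<in> G i \<Longrightarrow> y \<in> G j \<Longrightarrow> x * y \<in> G (i + j)"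
  using super_algebra_ad_grading[OF gg] by (simp add: super_algebra_def)

lemma parity_pow_even: "parity_pow g j \<in> G 0"
  using g_even one_even by (simp add: parity_pow_def)

lemma mult_parity_pow_G:
  assumes "x \<in> G i"
  shows "x * parity_pow g j \<in> G i" "parity_pow g j * x \<in> G i"
  using G_mult[OF assms parity_pow_even] G_mult[OF parity_pow_even assms]
  by (simp_all only: add_0_left add_0_right)

lemma clinear_\<phi>: "clinear \<phi>"
  unfolding \<phi>_def by (rule clinear_unbraid[OF gg clinear_ident(2)])

lemma \<phi>_tensor: "b \<in> G j \<Longrightarrow> \<phi> (a \<otimes> b) = (a * parity_pow g j) \<otimes> b"
  by (simp add: \<phi>_def unbraid_tensor[OF gg clinear_ident(2)])

lemma \<phi>_\<phi>: "\<phi> (\<phi> t) = t"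
  unfolding \<phi>_def by (rule unbraid_unbraid[OF gg gg clinear_ident(2)]) simp_all

lemma \<phi>_grade: "t \<in> ad_grading (g \<otimes> g) k \<Longrightarrow> \<phi> t \<in> ad_grading (g \<otimes> g) k"
  unfolding \<phi>_def by (rule unbraid_grade[OF gg gg clinear_ident(2)]) simp_all

lemma \<phi>_smult2: "\<phi> (smult2 G s t) = \<phi> s * \<phi> t"
  unfolding \<phi>_def by (rule unbraid_super_tensor_mult[OF gg gg clinear_ident(2)]) simp_all

lemma smult2_eq: "smult2 G s t = \<phi> (\<phi> s * \<phi> t)"
  using \<phi>_\<phi> \<phi>_smult2 by metis

lemma \<phi>_eq_iff: "\<phi> s = \<phi> t \<longleftrightarrow> s = t"
  using \<phi>_\<phi> by metis

lemma clinear_\<phi>3: "clinear \<phi>3"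
  unfolding \<phi>3_def by (rule clinear_unbraid[OF gg2 clinear_\<phi>])

lemma \<phi>3_tensor: "r \<in> ad_grading (g \<otimes> g) j \<Longrightarrow> \<phi>3 (a \<otimes> r) = (a * parity_pow g j) \<otimes> \<phi> r"
  unfolding \<phi>3_def by (rule unbraid_tensor[OF gg2 clinear_\<phi>])

lemma \<phi>3_\<phi>3: "\<phi>3 (\<phi>3 t) = t"
  unfolding \<phi>3_def by (rule unbraid_unbraid[OF gg gg2 clinear_\<phi> \<phi>_\<phi> \<phi>_grade])

lemma \<phi>3_eq_iff: "\<phi>3 s = \<phi>3 t \<longleftrightarrow> s = t"
  using \<phi>3_\<phi>3 by metis

lemma \<phi>3_smult3: "\<phi>3 (smult3 G s t) = \<phi>3 s * \<phi>3 t"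
  unfolding tensor_grading_G \<phi>3_def
  by (rule unbraid_super_tensor_mult[OF gg gg2 clinear_\<phi> \<phi>_\<phi> \<phi>_grade smult2_eq])

lemma \<phi>_one: "\<phi> 1 = 1" and \<phi>_gg: "\<phi> (g \<otimes> g) = g \<otimes> g"
  by (simp_all add: one_tensor_def \<phi>_tensor[OF one_even] \<phi>_tensor[OF g_even] parity_pow_def)

lemmas ulin = clinear_intros clinear_tensor_assoc clinear_\<phi> clinear_\<phi>3 clinear_comp[OF clinear_\<phi>] clinear_comp[OF clinear_\<phi>3]

lemma \<phi>_mult_gg: "\<phi> (t * (g \<otimes> g)) = \<phi> t * (g \<otimes> g)"
proof (rule tensor_graded_eqI[OF space_G space_G, of "\<lambda>t. \<phi> (t * (g \<otimes> g))" "\<lambda>t. \<phi> t * (g \<otimes> g)"])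
  fix a b i j assume b: "b \<in> G j"
  have bg: "b * g \<in> G j" using G_mult[OF b g_even] by (simp only: add_0_right)
  show "\<phi> ((a \<otimes> b) * (g \<otimes> g)) = \<phi> (a \<otimes> b) * (g \<otimes> g)"
    unfolding tensor_times \<phi>_tensor[OF b] \<phi>_tensor[OF bg]
    by (cases j; simp add: parity_pow_def mult.assoc)
qed (simp_all add: ulin)

lemma smult2_gg: "smult2 G t (g \<otimes> g) = t * (g \<otimes> g)"
  by (simp add: smult2_eq \<phi>_gg \<phi>_mult_gg \<phi>_\<phi>)

text \<open>
  Bracketing to the left, the same map is \<open>\<phi>\<close> on the first two factors, followed by the diagonal
  action of \<open>g\<close> according to the parity of the third. This is why the coproduct, for which \<open>g\<close> is
  grouplike, intertwines \<open>\<phi>\<close> and \<open>\<phi>3\<close>.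
\<close>

lemma \<phi>3_tensor_assoc:
  assumes b: "b \<in> G j"
  shows "\<phi>3 (tensor_assoc (s \<otimes> b)) = tensor_assoc ((\<phi> s * (parity_pow g j \<otimes> parity_pow g j)) \<otimes> b)"
proof (rule tensor_graded_eqI[OF space_G space_G, of "\<lambda>s. \<phi>3 (tensor_assoc (s \<otimes> b))"
      "\<lambda>s. tensor_assoc ((\<phi> s * (parity_pow g j \<otimes> parity_pow g j)) \<otimes> b)"])
  fix p q i k assume q: "q \<in> G k"
  have qb: "q \<otimes> b \<in> ad_grading (g \<otimes> g) (k + j)"
    unfolding tensor_grading_G[symmetric] tensor_grading_def
    by (rule cvs.span_base) (use q b in blast)
  show "\<phi>3 (tensor_assoc ((p \<otimes> q) \<otimes> b)) = tensor_assoc ((\<phi> (p \<otimes> q) * (parity_pow g j \<otimes> parity_pow g j)) \<otimes> b)"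
    using \<phi>3_tensor[OF qb, of p]
    by (simp add: tensor_assoc_tensor tensor_lift_tensor ulin \<phi>_tensor[OF q] \<phi>_tensor[OF b] tensor_times
        mult.assoc parity_pow_add[OF gg])
qed (simp_all add: ulin)

lemma twist_change_eq:
  assumes "t \<in> tensor_grading G G 0"
  shows "twist_change G g t = \<phi> t"
  unfolding twist_change_def
proof (rule tensor_grading_eqI[OF _ _ assms, of "\<lambda>J. tensor_map (hcomp G 0) (hcomp G 0) J -
    mult2 (g \<otimes> 1) (tensor_map (hcomp G 1) (hcomp G 1) J)" \<phi>])
  fix i j a b assume a: "a \<in> G i" and b: "b \<in> G j" and "i + j = 0"
  then have j: "j = i" by (cases i; cases j) auto
  show "tensor_map (hcomp G 0) (hcomp G 0) (a \<otimes> b) - mult2 (g \<otimes> 1) (tensor_map (hcomp G 1) (hcomp G 1) (a \<otimes> b))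
      = \<phi> (a \<otimes> b)"
    unfolding \<phi>_tensor[OF b] using j
    by (cases i; simp add: tensor_map_tensor clinear_hcomp space_G hcomp_homogeneous[OF space_G a]
        hcomp_homogeneous[OF space_G b] mult2_eq tensor_0 tensor_times ad_grading_commute[OF gg a]
        parity_pow_def tensor_minus_left scaleC_one)
qed (simp_all add: mult2_eq ulin clinear_hcomp space_G)

text \<open>
  For \<open>a \<otimes> b\<close> of total parity \<open>i\<close> with \<open>b\<close> odd, \<open>-(-1)\<^sup>i = (-1)\<^bsup>p(a)\<^esup>\<close> is the sign that turns \<open>g a\<close> into
  \<open>a g\<close>.
\<close>

lemma parity_change_comult:
  assumes "t \<in> ad_grading (g \<otimes> g) i"
  shows "tensor_map id (hcomp G 0) t - sign i *\<^sub>C mult2 (g \<otimes> 1) (tensor_map id (hcomp G 1) t) = \<phi> t"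
proof (rule tensor_grading_eqI[OF _ _ assms[folded tensor_grading_G],
      of "\<lambda>t. tensor_map id (hcomp G 0) t - sign i *\<^sub>C mult2 (g \<otimes> 1) (tensor_map id (hcomp G 1) t)" \<phi>])
  fix k j a b assume a: "a \<in> G k" and b: "b \<in> G j" and i: "k + j = i"
  show "tensor_map id (hcomp G 0) (a \<otimes> b) - sign i *\<^sub>C mult2 (g \<otimes> 1) (tensor_map id (hcomp G 1) (a \<otimes> b)) = \<phi> (a \<otimes> b)"
    using i[symmetric] unfolding \<phi>_tensor[OF b]
    by (cases k; cases j; simp add: tensor_map_tensor ulin clinear_hcomp space_G hcomp_homogeneous[OF space_G b]
        mult2_eq tensor_0 tensor_times ad_grading_commute[OF gg a] parity_pow_def tensor_minus_left
        scaleC_one)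
qed (simp_all add: mult2_eq ulin clinear_hcomp space_G)

lemma hcomp_sum: "hcomp G 0 x + hcomp G 1 x = x"
proof -
  have "hcomp G 1 x = x - hcomp G 0 x"
    by (rule hcomp_unique[OF space_G]) (use hcomp_in[OF space_G, where x = x and i = 0] in auto)
  then show ?thesis by simp
qed

end

text \<open>
  The product \<open>m2\<close> on the tensor square is left open: the super product gives Hopf superalgebras, the
  ordinary one gives ordinary Hopf algebras, and both passages of the correspondence are the
  same lemma. The equation for \<open>g \<otimes> g\<close> holds for both since \<open>g\<close> is even.
\<close>

locale graded_hopf = parity_element g for g :: "'a::complex_alg_1" +
  fixes A :: "'a hopf_data" and m2 :: "('a, 'a) tensor \<Rightarrow> ('a, 'a) tensor \<Rightarrow> ('a, 'a) tensor"
  assumes hopf: "hopf_axioms m2 A"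
    and m2_gg: "m2 t (g \<otimes> g) = t * (g \<otimes> g)"
    and comult_grade: "x \<in> ad_grading g i \<Longrightarrow> comult A x \<in> ad_grading (g \<otimes> g) i"
    and counit_grade: "x \<in> ad_grading g 1 \<Longrightarrow> counit A x = 0"
    and antipode_grade: "x \<in> ad_grading g i \<Longrightarrow> antipode A x \<in> ad_grading g i"
    and comult_g: "comult A g = g \<otimes> g" and counit_g: "counit A g = 1"
begin

abbreviation "D \<equiv> comult A"
abbreviation "e \<equiv> counit A"
abbreviation "S \<equiv> antipode A"
abbreviation "A' \<equiv> parity_change G g A"
abbreviation "D' \<equiv> comult A'"
abbreviation "S' \<equiv> antipode A'"

lemmas ax = hopf[unfolded hopf_axioms_def one_tensor]

lemma clinear_D: "clinear D" and clinear_e: "clinear e" and clinear_S: "clinear S"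
  using ax by blast+

lemmas lin = ulin clinear_D clinear_e clinear_S
  clinear_comp[OF clinear_D] clinear_comp[OF clinear_e] clinear_comp[OF clinear_S]

lemma D_one: "D 1 = 1"
  and e_mult: "e (x * y) = e x * e y" and e_one: "e 1 = 1"
  and coassoc: "tensor_assoc (tensor_map D id (D x)) = tensor_map id D (D x)"
  and counit_left: "tensor_lift (\<lambda>a b. e a *\<^sub>C b) (D x) = x"
  and counit_right: "tensor_lift (\<lambda>a b. e b *\<^sub>C a) (D x) = x"
  and antipode_left: "tensor_lift (\<lambda>a b. S a * b) (D x) = e x *\<^sub>C 1"
  and antipode_right: "tensor_lift (\<lambda>a b. a * S b) (D x) = e x *\<^sub>C 1"
  and D_m2: "D (x * y) = m2 (D x) (D y)"
  using ax by auto

lemma D_mult_g: "D (x * g) = D x * (g \<otimes> g)"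
  by (simp add: D_m2 comult_g m2_gg)

text \<open>
  The special case of anti-multiplicativity needed here can be shown for both products at once:
  evaluate \<open>S(x\<^sub>1 g) x\<^sub>2 S(x\<^sub>3)\<close> in two ways.
\<close>

lemma S_mult_g: "S (x * g) = g * S x"
proof -
  define B where "B t = tensor_lift (\<lambda>a r. tensor_lift (\<lambda>b c. S (a * g) * b * S c) r) t" for t
  have B: "B (a \<otimes> (b \<otimes> c)) = S (a * g) * b * S c" for a b c
    unfolding B_def by (simp add: lin tensor_lift_tensor)
  have "clinear B" unfolding B_def by (simp add: lin)
  note L = lin clinear_comp[OF this]
  let ?s = "\<lambda>t. tensor_lift (\<lambda>a b. S (a * g) * b) t" and ?r = "tensor_lift (\<lambda>a b. a * S b)"
  have "tensor_lift (\<lambda>a b. S a * b) (t * (g \<otimes> g)) = ?s t * g" for t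
    by (rule tensor_eqI[of "\<lambda>t. tensor_lift (\<lambda>a b. S a * b) (t * (g \<otimes> g))"])
      (simp_all add: L tensor_lift_tensor tensor_times mult.assoc)
  from this[of "D y" for y] have "?s (D y) * g = e y *\<^sub>C 1" for y
    by (simp add: antipode_left e_mult counit_g flip: D_mult_g)
  then have "?s (D y) * g * g = e y *\<^sub>C g" for y
    by (simp add: mult_scaleC_left)
  then have s: "?s (D y) = e y *\<^sub>C g" for y
    by (simp add: mult.assoc gg)
  have 1: "B (tensor_assoc (t \<otimes> c)) = ?s t * S c" for t c
    by (rule tensor_eqI[of "\<lambda>t. B (tensor_assoc (t \<otimes> c))"])
      (simp_all add: L tensor_assoc_tensor tensor_lift_tensor B)
  have 2: "B (a \<otimes> t) = S (a * g) * ?r t" for t a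
    by (rule tensor_eqI[of "\<lambda>t. B (a \<otimes> t)"])
      (simp_all add: L tensor_lift_tensor B mult.assoc)
  have 3: "B (tensor_assoc (tensor_map D id t)) = g * S (tensor_lift (\<lambda>a b. e a *\<^sub>C b) t)" for t
    by (rule tensor_eqI[of "\<lambda>t. B (tensor_assoc (tensor_map D id t))"])
      (simp_all add: L tensor_map_tensor tensor_lift_tensor 1 s mult_scaleC_left mult_scaleC_right
        clinear_scaleC[OF clinear_S])
  have 4: "B (tensor_map id D t) = S (tensor_lift (\<lambda>a b. e b *\<^sub>C a) t * g)" for t
    by (rule tensor_eqI[of "\<lambda>t. B (tensor_map id D t)"])
      (simp_all add: L tensor_map_tensor tensor_lift_tensor 2 antipode_right mult_scaleC_left mult_scaleC_right
        clinear_scaleC[OF clinear_S])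
  show ?thesis
    using 3[of "D x"] 4[of "D x"] by (simp add: coassoc counit_left counit_right)
qed

lemma D'_eq: "D' x = \<phi> (D x)"
proof -
  have "D' x = \<phi> (D (hcomp G 0 x)) + \<phi> (D (hcomp G 1 x))"
    using parity_change_comult[OF comult_grade[OF hcomp_in(1)[OF space_G]]]
    by (simp add: parity_change_def)
  also have "\<dots> = \<phi> (D (hcomp G 0 x + hcomp G 1 x))"
    by (simp add: clinear_add[OF clinear_\<phi>] clinear_add[OF clinear_D])
  finally show ?thesis by (simp add: hcomp_sum)
qed

lemma e'_eq: "counit A' = e"
  by (simp add: parity_change_def)

lemma clinear_D': "clinear D'"
  using clinear_comp[OF clinear_\<phi> clinear_D] by (simp add: D'_eq[abs_def])

lemma clinear_S': "clinear S'"
  by (simp add: parity_change_def lin clinear_hcomp space_G)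

lemma S'_eq: "x \<in> G i \<Longrightarrow> S' x = parity_pow g i * S x"
  by (cases i; simp add: parity_change_def hcomp_homogeneous[OF space_G] clinear_0[OF clinear_S])

lemmas lin' = lin clinear_D' clinear_S' clinear_comp[OF clinear_D'] clinear_comp[OF clinear_S']

lemma D'_mult_pow: "D' (x * parity_pow g j) = D' x * (parity_pow g j \<otimes> parity_pow g j)"
  by (cases j; simp add: parity_pow_def one_tensor D'_eq D_mult_g \<phi>_mult_gg)

lemma Dl_unbraid: "tensor_assoc (tensor_map D' id (\<phi> t)) = \<phi>3 (tensor_assoc (tensor_map D id t))"
proof (rule tensor_graded_eqI[OF space_G space_G, of "\<lambda>t. tensor_assoc (tensor_map D' id (\<phi> t))"])
  fix i j a b assume b: "b \<in> G j"
  show "tensor_assoc (tensor_map D' id (\<phi> (a \<otimes> b))) = \<phi>3 (tensor_assoc (tensor_map D id (a \<otimes> b)))"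
    by (simp add: tensor_map_tensor lin' \<phi>_tensor[OF b] \<phi>3_tensor_assoc[OF b] D'_mult_pow) (simp add: D'_eq)
qed (simp_all add: lin')

lemma Dr_unbraid: "tensor_map id D' (\<phi> t) = \<phi>3 (tensor_map id D t)"
proof (rule tensor_graded_eqI[OF space_G space_G, of "\<lambda>t. tensor_map id D' (\<phi> t)"])
  fix i j a b assume b: "b \<in> G j"
  show "tensor_map id D' (\<phi> (a \<otimes> b)) = \<phi>3 (tensor_map id D (a \<otimes> b))"
    by (simp add: tensor_map_tensor lin' \<phi>_tensor[OF b] \<phi>3_tensor[OF comult_grade[OF b]] D'_eq)
qed (simp_all add: lin')

lemma El_unbraid: "tensor_lift (\<lambda>a b. e a *\<^sub>C b) (\<phi> t) = tensor_lift (\<lambda>a b. e a *\<^sub>C b) t"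
proof (rule tensor_graded_eqI[OF space_G space_G, of "\<lambda>t. tensor_lift (\<lambda>a b. e a *\<^sub>C b) (\<phi> t)"])
  fix i j a b assume b: "b \<in> G j"
  show "tensor_lift (\<lambda>a b. e a *\<^sub>C b) (\<phi> (a \<otimes> b)) = tensor_lift (\<lambda>a b. e a *\<^sub>C b) (a \<otimes> b)"
    by (cases j; simp add: \<phi>_tensor[OF b] tensor_lift_tensor lin e_mult parity_pow_def counit_g)
qed (simp_all add: lin')

lemma Er_unbraid: "tensor_lift (\<lambda>a b. e b *\<^sub>C a) (\<phi> t) = tensor_lift (\<lambda>a b. e b *\<^sub>C a) t"
proof (rule tensor_graded_eqI[OF space_G space_G, of "\<lambda>t. tensor_lift (\<lambda>a b. e b *\<^sub>C a) (\<phi> t)"])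
  fix i j a b assume b: "b \<in> G j"
  show "tensor_lift (\<lambda>a b. e b *\<^sub>C a) (\<phi> (a \<otimes> b)) = tensor_lift (\<lambda>a b. e b *\<^sub>C a) (a \<otimes> b)"
    using b by (cases j; simp add: \<phi>_tensor[OF b] tensor_lift_tensor lin parity_pow_def counit_grade)
qed (simp_all add: lin')

lemma S_mult_pow: "S (x * parity_pow g j) = parity_pow g j * S x"
  by (simp add: parity_pow_def S_mult_g)

lemma antipode_left_unbraid:
  assumes "t \<in> ad_grading (g \<otimes> g) k"
  shows "tensor_lift (\<lambda>a b. S' a * b) (\<phi> t) = parity_pow g k * tensor_lift (\<lambda>a b. S a * b) t"
proof (rule tensor_grading_eqI[OF _ _ assms[folded tensor_grading_G], of "\<lambda>t. tensor_lift (\<lambda>a b. S' a * b) (\<phi> t)"])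
  fix i j a b assume a: "a \<in> G i" and b: "b \<in> G j" and k: "i + j = k"
  have "parity_pow g i * (parity_pow g j * (S a * b)) = parity_pow g k * (S a * b)"
    by (simp only: parity_pow_add[OF gg] k flip: mult.assoc)
  then show "tensor_lift (\<lambda>a b. S' a * b) (\<phi> (a \<otimes> b)) = parity_pow g k * tensor_lift (\<lambda>a b. S a * b) (a \<otimes> b)"
    by (simp add: \<phi>_tensor[OF b] tensor_lift_tensor lin' S'_eq[OF mult_parity_pow_G(1)[OF a]] S_mult_pow mult.assoc)
qed (simp_all add: lin')

lemma antipode_right_unbraid:
  "tensor_lift (\<lambda>a b. a * S' b) (\<phi> t) = tensor_lift (\<lambda>a b. a * S b) t"
proof (rule tensor_graded_eqI[OF space_G space_G, of "\<lambda>t. tensor_lift (\<lambda>a b. a * S' b) (\<phi> t)"])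
  fix i j a b assume b: "b \<in> G j"
  have "a * parity_pow g j * (parity_pow g j * S b) = a * (parity_pow g j * parity_pow g j) * S b"
    by (simp only: mult.assoc)
  also have "\<dots> = a * S b" by (simp add: parity_pow_def gg)
  finally show "tensor_lift (\<lambda>a b. a * S' b) (\<phi> (a \<otimes> b)) = tensor_lift (\<lambda>a b. a * S b) (a \<otimes> b)"
    by (simp add: \<phi>_tensor[OF b] tensor_lift_tensor lin' S'_eq[OF b])
qed (simp_all add: lin')

text \<open>
  The convolution of the new antipode with the identity acquires the factor \<open>g\<^bsup>p(x)\<^esup>\<close>
  (\<open>antipode_left_unbraid\<close>); it does no harm because the counit vanishes on odd \<open>x\<close>.
\<close>

lemma graded_hopf_parity_change:
  assumes m2': "\<And>s t. \<phi> (m2 s t) = m2' (\<phi> s) (\<phi> t)" and gg': "\<And>t. m2' t (g \<otimes> g) = t * (g \<otimes> g)"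
  shows "graded_hopf g A' m2'"
proof
  have left: "tensor_lift (\<lambda>a b. S' a * b) (D' x) = e x *\<^sub>C 1" for x
  proof (rule graded_eqI[OF space_G, of "\<lambda>x. tensor_lift (\<lambda>a b. S' a * b) (D' x)" "\<lambda>x. e x *\<^sub>C 1"])
    fix i x assume x: "x \<in> G i"
    show "tensor_lift (\<lambda>a b. S' a * b) (D' x) = e x *\<^sub>C 1"
      using x by (cases i; simp add: D'_eq antipode_left_unbraid[OF comult_grade[OF x]] antipode_left
          counit_grade parity_pow_def)
  qed (simp_all add: lin')
  have right: "tensor_lift (\<lambda>a b. a * S' b) (D' x) = e x *\<^sub>C 1" for x
    by (simp add: D'_eq antipode_right_unbraid antipode_right)
  have coassoc': "tensor_assoc (tensor_map D' id (D' x)) = tensor_map id D' (D' x)" for x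
    unfolding D'_eq[of x] by (simp add: Dl_unbraid Dr_unbraid coassoc)
  have counit': "tensor_lift (\<lambda>a b. e a *\<^sub>C b) (D' x) = x" "tensor_lift (\<lambda>a b. e b *\<^sub>C a) (D' x) = x" for x
    by (simp_all add: D'_eq El_unbraid Er_unbraid counit_left counit_right)
  have mult': "D' (x * y) = m2' (D' x) (D' y)" for x y
    by (simp add: D'_eq D_m2 m2')
  have one': "D' 1 = 1" by (simp add: D'_eq D_one \<phi>_one)
  show "hopf_axioms m2' A'"
    unfolding hopf_axioms_def e'_eq one_tensor
    using clinear_D' clinear_S' clinear_e coassoc' counit' one' mult' e_mult e_one left right
    by simp
  show "m2' t (g \<otimes> g) = t * (g \<otimes> g)" for t by (rule gg')
  show "D' x \<in> ad_grading (g \<otimes> g) i" if "x \<in> G i" for x i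
    unfolding D'_eq by (intro \<phi>_grade comult_grade that)
  show "counit A' x = 0" if "x \<in> G 1" for x
    unfolding e'_eq by (rule counit_grade[OF that])
  show "S' x \<in> G i" if "x \<in> G i" for x i
    unfolding S'_eq[OF that] by (intro mult_parity_pow_G antipode_grade that)
  show "D' g = g \<otimes> g" by (simp add: D'_eq comult_g \<phi>_gg)
  show "counit A' g = 1" by (simp add: e'_eq counit_g)
qed

lemma parity_change_parity_change:
  assumes m2': "\<And>s t. \<phi> (m2 s t) = m2' (\<phi> s) (\<phi> t)" and gg': "\<And>t. m2' t (g \<otimes> g) = t * (g \<otimes> g)"
  shows "parity_change G g A' = A"
proof -
  interpret A': graded_hopf g A' m2' by (rule graded_hopf_parity_change[OF assms])
  have "antipode (parity_change G g A') x = S x" for x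
  proof (rule graded_eqI[OF space_G, of "antipode (parity_change G g A')" S])
    fix i x assume x: "x \<in> G i"
    have "parity_pow g i * (parity_pow g i * S x) = S x"
      by (simp add: parity_pow_def gg flip: mult.assoc)
    then show "antipode (parity_change G g A') x = S x"
      by (simp add: A'.S'_eq[OF x] S'_eq[OF x])
  qed (simp_all add: A'.clinear_S' clinear_S)
  then show ?thesis
    by (intro hopf_data.equality ext) (simp_all add: A'.D'_eq D'_eq \<phi>_\<phi> A'.e'_eq e'_eq)
qed

end

section \<open>Twists of Hopf superalgebras\<close>

lemma graded_hopf_super_iff:
  assumes gg: "g * g = 1"
  shows "graded_hopf g A (smult2 (ad_grading g)) \<longleftrightarrow>
    hopf_superalgebra (ad_grading g) A \<and> grouplike A g"
proof -
  interpret parity_element g by unfold_locales (rule gg)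
  show ?thesis
    unfolding hopf_superalgebra_def grouplike_def graded_hopf_def graded_hopf_axioms_def tensor_grading_G
    using smult2_gg super_algebra_ad_grading[OF gg] parity_element_axioms by auto
qed

text \<open>
  In an ordinary Hopf algebra the structure maps respect the grading automatically: they are
  compatible with conjugation by the grouplike element \<open>g\<close>, and the antipode fixes \<open>g\<close>.
\<close>

lemma graded_hopf_ordinary_iff:
  assumes gg: "g * g = 1"
  shows "graded_hopf g A (*) \<longleftrightarrow> hopf_algebra A \<and> grouplike A g"
proof
  assume "graded_hopf g A (*)"
  then show "hopf_algebra A \<and> grouplike A g"
    by (simp add: graded_hopf_def graded_hopf_axioms_def hopf_algebra_def grouplike_def mult2_eq)
next
  assume *: "hopf_algebra A \<and> grouplike A g"
  interpret parity_element g by unfold_locales (rule gg)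
  interpret hopf A using * by unfold_locales simp
  have Dg: "comult A g = g \<otimes> g" and eg: "counit A g = 1" using * by (simp_all add: grouplike_def)
  have "S g * g = 1"
    using antipode_left[of g] by (simp add: Dg sandwich_tensor eg scaleC_one)
  then have "S g * (g * g) = g" by (simp flip: mult.assoc)
  then have Sg: "S g = g" by (simp add: gg)
  show "graded_hopf g A (*)"
  proof
    show "hopf_axioms (*) A" using * by (simp add: hopf_algebra_def mult2_eq)
    show "comult A g = g \<otimes> g" "counit A g = 1" by (fact Dg eg)+
    fix x i assume x: "x \<in> G i"
    note gx = ad_grading_commute[OF gg x]
    have "D (g * x) = D (sign i *\<^sub>C (x * g))" by (simp only: gx)
    then show "comult A x \<in> ad_grading (g \<otimes> g) i"
      by (simp add: ad_grading_iff[OF gg2] D_mult Dg clinear_scaleC[OF clinear_D])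
    have "S (g * x) = S (sign i *\<^sub>C (x * g))" by (simp only: gx)
    then have "S x * g = sign i *\<^sub>C (g * S x)" by (simp add: S_mult Sg clinear_scaleC[OF clinear_S])
    then show "antipode A x \<in> G i"
      by (simp add: ad_grading_iff[OF gg] scaleC_scaleC) (cases i; simp add: parity_pow_def scaleC_one)
  next
    fix x assume x: "x \<in> G 1"
    have "e (g * x) = e (sign 1 *\<^sub>C (x * g))" by (simp only: ad_grading_commute[OF gg x])
    then have "e g * e x = sign 1 *\<^sub>C (e x * e g)"
      by (simp only: e_mult clinear_scaleC[OF clinear_e])
    then show "counit A x = 0"
      by (simp add: eg parity_pow_def scaleC_complex_def)
  qed simp
qed

locale super_hopf = graded_hopf g A "smult2 (ad_grading g)" for g :: "'a::complex_alg_1" and A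
begin

lemma graded_hopf_A': "graded_hopf g A' (*)"
  by (rule graded_hopf_parity_change) (simp_all add: \<phi>_smult2)

lemma even_twist_iff:
  assumes t: "t \<in> tensor_grading G G 0"
  shows "even_twist A' g (\<phi> t) \<longleftrightarrow> super_twist G A t"
proof -
  have t0: "t \<in> ad_grading (g \<otimes> g) 0" using t by (simp only: tensor_grading_G)
  have "(g \<otimes> g) * \<phi> t = \<phi> t * (g \<otimes> g)"
    using \<phi>_grade[OF t0] by (simp add: ad_grading_0_iff[OF gg2])
  moreover have "(\<exists>K. \<phi> t * K = 1 \<and> K * \<phi> t = 1) \<longleftrightarrow> (\<exists>K. smult2 G t K = 1 \<and> smult2 G K t = 1)"
  proof -
    have "smult2 G t K = 1 \<and> smult2 G K t = 1 \<longleftrightarrow> \<phi> t * \<phi> K = 1 \<and> \<phi> K * \<phi> t = 1" for K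
      using \<phi>_eq_iff[of _ 1] by (simp add: \<phi>_one flip: \<phi>_smult2)
    then show ?thesis using \<phi>_\<phi> by metis
  qed
  moreover have "tensor_assoc (tensor_map D' id (\<phi> t)) * tensor_assoc (\<phi> t \<otimes> 1) =
      tensor_map id D' (\<phi> t) * (1 \<otimes> \<phi> t) \<longleftrightarrow>
    smult3 G (tensor_assoc (tensor_map D id t)) (tensor_assoc (t \<otimes> 1)) =
      smult3 G (tensor_map id D t) (1 \<otimes> t)"
  proof -
    have "tensor_assoc (\<phi> t \<otimes> 1) = \<phi>3 (tensor_assoc (t \<otimes> 1))"
      by (simp add: \<phi>3_tensor_assoc[OF one_even] parity_pow_def one_tensor)
    moreover have "1 \<otimes> \<phi> t = \<phi>3 (1 \<otimes> t)"
      by (simp add: \<phi>3_tensor[OF t0] parity_pow_def)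
    ultimately show ?thesis
      using \<phi>3_eq_iff by (simp add: Dl_unbraid Dr_unbraid flip: \<phi>3_smult3)
  qed
  ultimately show ?thesis
    using t by (simp add: even_twist_def twist_def super_twist_def twist_axioms_def mult2_eq one_tensor
        e'_eq El_unbraid Er_unbraid)
qed

text \<open>
  The twisted superalgebra is identified with the parity change of the ordinary twisted Hopf algebra,
  so its axioms need no separate proof.
\<close>

lemma corresponds_twisted:
  assumes t: "super_twist G A t"
  shows "corresponds G (super_twisted G A t) g (twisted A' (\<phi> t)) g"
proof -
  interpret A': graded_hopf g A' "(*)" by (rule graded_hopf_A')
  have even: "t \<in> tensor_grading G G 0" using t by (simp add: super_twist_def)
  then have t0: "t \<in> ad_grading (g \<otimes> g) 0" by (simp only: tensor_grading_G)
  have J: "even_twist A' g (\<phi> t)" using t even_twist_iff[OF even] by simp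
  then obtain K where K: "\<phi> t * K = 1" "K * \<phi> t = 1"
    by (auto simp: even_twist_def twist_def twist_axioms_def mult2_eq one_tensor)
  interpret T: hopf_twist A' "\<phi> t" K
  proof
    show "hopf_algebra A'" using A'.hopf by (simp add: hopf_algebra_def mult2_eq)
  qed (use J K in \<open>simp_all add: even_twist_def twist_def twist_axioms_def mult2_eq one_tensor\<close>)
  let ?H = "twisted A' (\<phi> t)"
  have comm: "(g \<otimes> g) * \<phi> t = \<phi> t * (g \<otimes> g)"
    using \<phi>_grade[OF t0] by (simp add: ad_grading_0_iff[OF gg2])
  have "grouplike ?H g"
    by (simp add: grouplike_def T.twisted_simps A'.comult_g A'.counit_g mult.assoc comm T.cancel)
  then have H: "graded_hopf g ?H (*)"
    using T.hopf_algebra_twisted by (simp add: graded_hopf_ordinary_iff[OF gg])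
  interpret H: graded_hopf g ?H "(*)" by (rule H)
  have smult: "\<phi> (x * y) = smult2 G (\<phi> x) (\<phi> y)" for x y
    by (simp add: smult2_eq \<phi>_\<phi>)
  have K_inv: "inverse_wrt (smult2 G) 1 t = \<phi> K"
    unfolding inverse_wrt_def
  proof (rule the_equality)
    show "smult2 G t (\<phi> K) = 1 \<and> smult2 G (\<phi> K) t = 1"
      using K by (simp add: smult2_eq \<phi>_\<phi> \<phi>_one)
    fix y assume "smult2 G t y = 1 \<and> smult2 G y t = 1"
    then have "\<phi> t * \<phi> y = 1" using \<phi>_smult2[of t y] by (simp add: \<phi>_one)
    then have "K * (\<phi> t * \<phi> y) = K" by simp
    then have "\<phi> y = K" by (simp add: K(2) flip: mult.assoc)
    then show "y = \<phi> K" using \<phi>_\<phi>[of y] by simp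
  qed
  \<comment> \<open>no power of \<open>g\<close> appears, because \<open>t\<close> is even\<close>
  have Q: "twist_Q A t = T.Q"
    using antipode_left_unbraid[OF t0] by (simp add: T.twist_Q_eq[symmetric] twist_Q_def parity_pow_def)
  have "T.Q \<in> G 0"
    unfolding Q[symmetric] twist_Q_def
  proof (rule tensor_grading_in[OF _ subspace_ad_grading[OF gg] even])
    fix i j a b assume a: "a \<in> G i" and b: "b \<in> G j" and "i + j = 0"
    have "S a * b \<in> G 0"
      unfolding \<open>i + j = 0\<close>[symmetric] by (rule G_mult[OF antipode_grade[OF a] b])
    then show "tensor_lift (\<lambda>a b. S a * b) (a \<otimes> b) \<in> G 0"
      by (simp add: tensor_lift_tensor lin)
  qed (simp add: lin)
  then have gQ: "g * T.Q = T.Q * g" by (simp add: ad_grading_0_iff[OF gg])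
  have "T.Q' * (g * T.Q) * T.Q' = T.Q' * (T.Q * g) * T.Q'" by (simp only: gQ)
  then have gQ': "T.Q' * g = g * T.Q'"
    by (simp add: mult.assoc T.Q_Q') (simp add: T.Q'_Q flip: mult.assoc)
  have twisted: "super_twisted G A t = parity_change G g ?H"
  proof (intro hopf_data.equality ext)
    fix x
    show "comult (super_twisted G A t) x = comult (parity_change G g ?H) x"
      by (simp add: super_twisted_def twisted_wrt_def one_tensor K_inv H.D'_eq T.twisted_simps smult D'_eq \<phi>_\<phi>)
    show "antipode (super_twisted G A t) x = antipode (parity_change G g ?H) x"
    proof (rule graded_eqI[OF space_G, of "antipode (super_twisted G A t)"])
      fix i x assume x: "x \<in> G i"
      \<comment> \<open>the two powers of \<open>g\<close> meet across \<open>Q'\<close>, which commutes with \<open>g\<close>\<close>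
      have "parity_pow g i * (T.Q' * (parity_pow g i * S x) * T.Q) = T.Q' * S x * T.Q"
      proof (cases i)
        case one
        have "g * (T.Q' * (g * S x) * T.Q) = (g * T.Q') * g * S x * T.Q" by (simp only: mult.assoc)
        also have "\<dots> = T.Q' * (g * g) * S x * T.Q" by (simp only: gQ'[symmetric] mult.assoc)
        finally show ?thesis using one by (simp add: parity_pow_def gg)
      qed (simp add: parity_pow_def)
      then show "antipode (super_twisted G A t) x = antipode (parity_change G g ?H) x"
        by (simp add: super_twisted_def twisted_wrt_def Q T.ring_inv_Q H.S'_eq[OF x] T.twisted_simps S'_eq[OF x])
    qed (simp_all add: super_twisted_def twisted_wrt_def lin H.clinear_S')
    show "counit (super_twisted G A t) x = counit (parity_change G g ?H) x"
      by (simp add: super_twisted_def twisted_wrt_def H.e'_eq T.twisted_simps e'_eq)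
  qed simp
  have "graded_hopf g (parity_change G g ?H) (smult2 G)"
    by (rule H.graded_hopf_parity_change[OF smult smult2_gg])
  then have "hopf_superalgebra G (parity_change G g ?H)" "grouplike (parity_change G g ?H) g"
    by (simp_all add: graded_hopf_super_iff[OF gg])
  moreover have "parity_change G g (parity_change G g ?H) = ?H"
    by (rule H.parity_change_parity_change[OF smult smult2_gg])
  moreover have "acts_by_parity G g"
    by (simp add: acts_by_parity_def ad_grading_def)
  ultimately show ?thesis
    unfolding twisted corresponds_def super_with_parity_element_def hopf_with_involution_def
      associated_hopf_def associated_super_def
    using T.hopf_algebra_twisted \<open>grouplike ?H g\<close> by (simp add: power2_eq_square gg)
qed

lemma bij_betw_twist_change:
  "bij_betw (twist_change G g) {t. super_twist G A t} {J. even_twist A' g J}"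
proof (rule bij_betw_byWitness[where f' = \<phi>])
  have even: "t \<in> tensor_grading G G 0" if "super_twist G A t" for t
    using that by (simp add: super_twist_def)
  have even': "\<phi> J \<in> tensor_grading G G 0" if "even_twist A' g J" for J
  proof -
    have "J \<in> ad_grading (g \<otimes> g) 0" using that by (simp add: even_twist_def mult2_eq ad_grading_0_iff[OF gg2])
    then show ?thesis unfolding tensor_grading_G by (rule \<phi>_grade)
  qed
  show "\<forall>t\<in>{t. super_twist G A t}. \<phi> (twist_change G g t) = t"
    by (simp add: twist_change_eq even \<phi>_\<phi>)
  show "\<forall>J\<in>{J. even_twist A' g J}. twist_change G g (\<phi> J) = J"
    by (simp add: twist_change_eq even' \<phi>_\<phi>)
  show "twist_change G g ` {t. super_twist G A t} \<subseteq> {J. even_twist A' g J}"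
    by (auto simp: twist_change_eq even even_twist_iff)
  show "\<phi> ` {J. even_twist A' g J} \<subseteq> {t. super_twist G A t}"
    using even_twist_iff[OF even'] by (auto simp: \<phi>_\<phi>)
qed

end

theorem proposition3p2p1:
  fixes G :: "bit \<Rightarrow> 'a::complex_alg_1 set" and A :: "'a hopf_data" and g :: 'a
  assumes "hopf_superalgebra G A"
    and "grouplike A g" and "g^2 = 1" and "acts_by_parity G g"
  shows "(\<forall>Js\<in>tensor_grading G G 0.
           \<forall>J0\<in>tensor_span (G 0) (G 0). \<forall>J1\<in>tensor_span (G 1) (G 1). Js = J0 + J1 \<longrightarrow>
             (let J = J0 - mult2 (g \<otimes> 1) J1; H = associated_hopf G A g in
               (even_twist H g J \<longleftrightarrow> super_twist G A Js) \<and>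
               (super_twist G A Js \<longrightarrow>
                 corresponds G (super_twisted G A Js) g (twisted H J) g))) \<and>
         bij_betw (twist_change G g)
           {Js. super_twist G A Js} {J. even_twist (associated_hopf G A g) g J}"
proof -
  have gg: "g * g = 1" using assms(3) by (simp add: power2_eq_square)
  have space: "super_space G" using assms(1) by (simp add: hopf_superalgebra_def super_algebra_def)
  have G: "G = ad_grading g" by (rule acts_by_parity_eq_ad_grading[OF gg space assms(4)])
  interpret super_hopf g A
    unfolding super_hopf_def graded_hopf_super_iff[OF gg] using assms(1,2) by (simp add: G)
  show ?thesis
    unfolding G associated_hopf_def Let_def
  proof (intro conjI ballI impI)
    fix Js J0 J1
    assume Js: "Js \<in> tensor_grading (ad_grading g) (ad_grading g) 0"
      and J0: "J0 \<in> tensor_span (ad_grading g 0) (ad_grading g 0)"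
      and J1: "J1 \<in> tensor_span (ad_grading g 1) (ad_grading g 1)" and eq: "Js = J0 + J1"
    have J: "J0 - mult2 (g \<otimes> 1) J1 = \<phi> Js"
      using twist_change_decomposition[OF space_G J0 J1] twist_change_eq[OF Js] by (simp add: eq)
    show "even_twist A' g (J0 - mult2 (g \<otimes> 1) J1) \<longleftrightarrow> super_twist (ad_grading g) A Js"
      unfolding J by (rule even_twist_iff[OF Js])
    show "corresponds (ad_grading g) (super_twisted (ad_grading g) A Js) g (twisted A' (J0 - mult2 (g \<otimes> 1) J1)) g"
      if "super_twist (ad_grading g) A Js"
      unfolding J by (rule corresponds_twisted[OF that])
  qed (rule bij_betw_twist_change)
qed

end
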